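(* Consider the Gaussian non-random many-access channel in which, at blocklength $n$, there are $k_n$ users, all active with probability one, with noise variance $N_0/2$ per symbol. For the joint probability of error (JPE), the $\epsilon$-capacity per unit-energy $\dot C_\epsilon$ has the following behaviour: 1) If $k_n=\omega(1)$ and $k_n=o(n/\log n)$, then $\dot C_\epsilon=\frac{\log e}{N_0}$ for every $0<\epsilon<1$. 2) If $k_n=\omega(n/\log n)$, then $\dot C_\epsilon=0$ for every $0<\epsilon<1$.
   Context: Logarithms $\log$ are to base 2. For nonnegative sequences: $a_n=o(b_n)$ means $\lim a_n/b_n=0$; $a_n=\omega(b_n)$ means $\lim a_n/b_n=\infty$. Channel. At blocklength $n$ there are $k_n$ users (a positive integer depending on $n$). User $i$ has a message $W_i$; the messages are independent and uniform on $\{1,\ldots,M_n\}$. User $i$ sends a codeword $\mathbf{x}_i(W_i)\in\mathbb{R}^n$ and the receiver observes $\mathbf{Y}=\sum_{i=1}^{k_n}\mathbf{x}_i(W_i)+\mathbf{Z}$, where $\mathbf{Z}$ has $n$ i.i.d. $\mathcal{N}(0,N_0/2)$ components, independent of the messages; $N_0>0$ is fixed. Codes. A symmetric $(n,M_n,E_n,\epsilon)$ code consists of encoding functions $w\mapsto\mathbf{x}_i(w)$, $i=1,\ldots,k_n$ (one codebook per user), with $\sum_{j=1}^n x_{ij}(w)^2\le E_n$ for all $w$, and a decoding function mapping $\mathbf{Y}$ to $(\hat W_1,\ldots,\hat W_{k_n})$ whose joint probability of error satisfies $P_e^{(n)}=\Pr\{(\hat W_1,\ldots,\hat W_{k_n})\ne(W_1,\ldots,W_{k_n})\}\le\epsilon$.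 A rate per unit-energy $\dot R$ is $\epsilon$-achievable if for every $\delta>0$ there exists $n_0$ such that for every $n\ge n_0$ there is an $(n,M_n,E_n,\epsilon)$ code with $\frac{\log M_n}{E_n}>\dot R-\delta$. The $\epsilon$-capacity per unit-energy $\dot C_\epsilon$ is the supremum of all $\epsilon$-achievable rates per unit-energy. *)

theory Defs
  imports "HOL-Probability.Probability" "HOL-Library.Landau_Symbols"
begin

definition message_space :: "nat \<Rightarrow> nat \<Rightarrow> (nat \<Rightarrow> nat) measure" where
  "message_space K M = (\<Pi>\<^sub>M i\<in>{1..K}. uniform_count_measure {1..M})"

text \<open>\<^const>\<open>normal_density\<close> takes the standard deviation, not the variance, as its
  second argument.\<close>

definition noise_space :: "real \<Rightarrow> nat \<Rightarrow> (nat \<Rightarrow> real) measure" where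
  "noise_space N0 n = (\<Pi>\<^sub>M j\<in>{1..n}. density lborel (normal_density 0 (sqrt (N0 / 2))))"

text \<open>A family of codebooks is a function \<open>x\<close> such that \<open>x i w j\<close> is the \<open>j\<close>-th symbol of the
  codeword of user \<open>i\<close> for message \<open>w\<close>. Vectors of length \<open>n\<close> are extensional functions on
  \<open>{1..n}\<close>.\<close>

definition channel_output ::
  "nat \<Rightarrow> nat \<Rightarrow> (nat \<Rightarrow> nat \<Rightarrow> nat \<Rightarrow> real) \<Rightarrow> (nat \<Rightarrow> nat) \<Rightarrow> (nat \<Rightarrow> real) \<Rightarrow> (nat \<Rightarrow> real)" where
  "channel_output K n x w z = (\<lambda>j\<in>{1..n}. (\<Sum>i=1..K. x i (w i) j) + z j)"

definition decoders :: "nat \<Rightarrow> nat \<Rightarrow> nat \<Rightarrow> ((nat \<Rightarrow> real) \<Rightarrow> (nat \<Rightarrow> nat)) set" where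
  "decoders K n M = (\<Pi>\<^sub>M j\<in>{1..n}. borel) \<rightarrow>\<^sub>M count_space ({1..K} \<rightarrow>\<^sub>E {1..M})"

definition joint_error_prob ::
  "real \<Rightarrow> nat \<Rightarrow> nat \<Rightarrow> nat \<Rightarrow> (nat \<Rightarrow> nat \<Rightarrow> nat \<Rightarrow> real) \<Rightarrow> ((nat \<Rightarrow> real) \<Rightarrow> (nat \<Rightarrow> nat)) \<Rightarrow> real" where
  "joint_error_prob N0 K n M x d =
     \<P>((w, z) in message_space K M \<Otimes>\<^sub>M noise_space N0 n. d (channel_output K n x w z) \<noteq> w)"

definition symmetric_code ::
  "real \<Rightarrow> nat \<Rightarrow> nat \<Rightarrow> nat \<Rightarrow> real \<Rightarrow> real \<Rightarrow>
   (nat \<Rightarrow> nat \<Rightarrow> nat \<Rightarrow> real) \<Rightarrow> ((nat \<Rightarrow> real) \<Rightarrow> (nat \<Rightarrow> nat)) \<Rightarrow> bool" where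
  "symmetric_code N0 K n M E \<epsilon> x d \<longleftrightarrow>
     (\<forall>i\<in>{1..K}. \<forall>w\<in>{1..M}. (\<Sum>j=1..n. (x i w j)\<^sup>2) \<le> E) \<and>
     d \<in> decoders K n M \<and>
     joint_error_prob N0 K n M x d \<le> \<epsilon>"

text \<open>The number of users at blocklength \<open>n\<close> is \<open>k n\<close>. Positivity of \<open>M\<close> and \<open>E\<close> makes the
  message distribution and the quotient meaningful.\<close>

definition achievable :: "real \<Rightarrow> (nat \<Rightarrow> nat) \<Rightarrow> real \<Rightarrow> real \<Rightarrow> bool" where
  "achievable N0 k \<epsilon> R \<longleftrightarrow>
     (\<forall>\<delta>>0. \<exists>n0. \<forall>n\<ge>n0. \<exists>M\<ge>1. \<exists>E>0.
        (\<exists>x d. symmetric_code N0 (k n) n M E \<epsilon> x d) \<and> log 2 (real M) / E > R - \<delta>)"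

text \<open>The supremum is taken in \<^typ>\<open>ereal\<close>, where it is meaningful without any boundedness
  assumption.\<close>

definition capacity_per_unit_energy :: "real \<Rightarrow> (nat \<Rightarrow> nat) \<Rightarrow> real \<Rightarrow> ereal" where
  "capacity_per_unit_energy N0 k \<epsilon> = (SUP R\<in>{R. achievable N0 k \<epsilon> R}. ereal R)"

text \<open>\<^const>\<open>measure\<close> is zero on non-measurable sets, so the following two facts are needed for
  \<^const>\<open>joint_error_prob\<close> to be the probability of the error event.\<close>

lemma prob_space_message_noise:
  assumes "N0 > 0" "M \<ge> 1"
  shows "prob_space (message_space K M \<Otimes>\<^sub>M noise_space N0 n)"
proof -
  have a: "prob_space (message_space K M)"
    unfolding message_space_def using assms
    by (intro prob_space_PiM prob_space_uniform_count_measure) auto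
  have b: "prob_space (noise_space N0 n)"
    unfolding noise_space_def using assms
    by (intro prob_space_PiM prob_space_normal_density) auto
  interpret a: prob_space "message_space K M" by (fact a)
  interpret b: prob_space "noise_space N0 n" by (fact b)
  interpret pair_prob_space "message_space K M" "noise_space N0 n" ..
  show ?thesis by unfold_locales
qed

lemma error_event_measurable:
  assumes d: "d \<in> decoders K n M"
  shows "{(w, z) \<in> space (message_space K M \<Otimes>\<^sub>M noise_space N0 n).
            d (channel_output K n x w z) \<noteq> w} \<in> sets (message_space K M \<Otimes>\<^sub>M noise_space N0 n)"
    (is "?A \<in> sets ?P")
proof -
  let ?W = "{1..K} \<rightarrow>\<^sub>E {1..M}" and ?N = "noise_space N0 n"
  have sp: "space (message_space K M) = ?W"
    by (simp add: message_space_def space_PiM space_uniform_count_measure)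
  have setsN: "sets ?N = sets (\<Pi>\<^sub>M j\<in>{1..n}. borel)"
    unfolding noise_space_def by (intro sets_PiM_cong) auto
  have single: "{w} \<in> sets (message_space K M)" if "w \<in> ?W" for w
  proof -
    have "{w} = Pi\<^sub>E {1..K} (\<lambda>i. {w i})"
      using that by (intro PiE_singleton[symmetric]) (simp add: PiE_iff)
    also have "\<dots> \<in> sets (message_space K M)"
      unfolding message_space_def using that
      by (intro sets_PiM_I_finite) (auto simp: sets_uniform_count_measure)
    finally show ?thesis .
  qed
  have "?A = (\<Union>w\<in>?W. {w} \<times> {z \<in> space ?N. d (channel_output K n x w z) \<noteq> w})"
    by (auto simp: space_pair_measure sp)
  also have "\<dots> \<in> sets ?P"
  proof (intro sets.finite_UN pair_measureI single)
    show "finite ?W" by (intro finite_PiE) auto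
    fix w assume w: "w \<in> ?W"
    have "channel_output K n x w \<in> (\<Pi>\<^sub>M j\<in>{1..n}. borel) \<rightarrow>\<^sub>M (\<Pi>\<^sub>M j\<in>{1..n}. borel)"
      unfolding channel_output_def by measurable
    then have "(\<lambda>z. d (channel_output K n x w z)) \<in> ?N \<rightarrow>\<^sub>M count_space ?W"
      using d unfolding decoders_def measurable_cong_sets[OF setsN refl]
      by (rule measurable_compose)
    then have "(\<lambda>z. d (channel_output K n x w z)) -` (?W - {w}) \<inter> space ?N \<in> sets ?N"
      by (rule measurable_sets) auto
    moreover have "(\<lambda>z. d (channel_output K n x w z)) -` (?W - {w}) \<inter> space ?N =
        {z \<in> space ?N. d (channel_output K n x w z) \<noteq> w}"
      using measurable_space[OF \<open>(\<lambda>z. d (channel_output K n x w z)) \<in> ?N \<rightarrow>\<^sub>M count_space ?W\<close>]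
      by auto
    ultimately show "{z \<in> space ?N. d (channel_output K n x w z) \<noteq> w} \<in> sets ?N" by simp
  qed
  finally show ?thesis .
qed

end

theory Submission
  imports Defs "HOL-Real_Asymp.Real_Asymp"
begin

text \<open>Both converses compare the Gaussian output laws of many hypotheses with one reference law, so
  no mutual information is needed. Since the decoding regions are disjoint, the reference law gives
  them total mass at most one, and a tail bound on the log-likelihood ratio limits how many
  hypotheses can be decoded. If only the message of one user varies, the reference is the law
  centred at the other users' contribution and one gets \<open>ln M \<le> (1 + o(1)) E / N0\<close> as
  \<open>E \<rightarrow> \<infinity>\<close>. If exactly one of the \<open>k\<close> users changes its message, all hypotheses
  lie within squared distance \<open>4 E\<close>, which forces \<open>E\<close> to grow at least like \<open>ln k\<close>.
  If all messages vary, the reference is a wider Gaussian of variance \<open>N0/2 + k E/n\<close>,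
  centred at the superposition of the codebook means; this bounds the sum rate, and together with
  \<open>E \<ge> c ln k\<close> and \<open>k ln k / n \<rightarrow> \<infinity>\<close> it makes the rate per unit-energy vanish.

  For achievability each user gets its own block of about \<open>n/k\<close> symbols and an antipodal
  codebook with random signs, decoded by thresholding correlations. With energy \<open>E = C ln n\<close>
  and block length much larger than \<open>ln n\<close>, the error per user is at most \<open>2/n\<^sup>2\<close>, so
  a union bound over the users suffices.\<close>

section \<open>Product Gaussian measures\<close>

text \<open>Rewriting \<open>1\<close> to \<open>Suc 0\<close> would disturb the index sets
  \<open>{1..n}\<close>, \<open>{1..K}\<close>, \<open>{1..M}\<close> and the index \<open>1\<close>
  of the first user.\<close>

declare One_nat_def [simp del]

abbreviation vec_space :: "nat \<Rightarrow> (nat \<Rightarrow> real) measure" where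
  "vec_space n \<equiv> \<Pi>\<^sub>M j\<in>{1..n}. borel"

text \<open>\<open>s\<close> is the standard deviation, as in \<open>normal_density\<close>. The
  family contains the noise, the output law for each message tuple, and all reference laws of the
  converses.\<close>

definition gauss :: "nat \<Rightarrow> (nat \<Rightarrow> real) \<Rightarrow> real \<Rightarrow> (nat \<Rightarrow> real) measure" where
  "gauss n c s = (\<Pi>\<^sub>M j\<in>{1..n}. density lborel (normal_density (c j) s))"

lemma noise_space_eq_gauss: "noise_space N0 n = gauss n (\<lambda>_. 0) (sqrt (N0 / 2))"
  by (simp add: noise_space_def gauss_def)

lemma sets_gauss [measurable_cong, simp]: "sets (gauss n c s) = sets (vec_space n)"
  unfolding gauss_def by (intro sets_PiM_cong) auto

lemma space_gauss [simp]: "space (gauss n c s) = space (vec_space n)"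
  by (rule sets_eq_imp_space_eq) simp

lemma product_prob_space_normal:
  assumes "s > 0"
  shows "product_prob_space (\<lambda>j. density lborel (normal_density (c j) s))"
  using assms prob_space_normal_density
  by (auto simp: product_prob_space_def product_prob_space_axioms_def product_sigma_finite_def
      intro: prob_space_imp_sigma_finite)

lemma prob_space_gauss: "s > 0 \<Longrightarrow> prob_space (gauss n c s)"
  unfolding gauss_def by (intro prob_space_PiM prob_space_normal_density)

text \<open>Both sides agree on boxes, where the integral of the product density factorises. An
  explicit joint density is what allows likelihood ratios to be compared pointwise.\<close>

lemma gauss_eq_density:
  assumes s: "s > 0"
  shows "gauss n c s = density (\<Pi>\<^sub>M j\<in>{1..n}. lborel)
           (\<lambda>y. ennreal (\<Prod>j\<in>{1..n}. normal_density (c j) s (y j)))"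
proof -
  interpret N: product_prob_space "\<lambda>j. density lborel (normal_density (c j) s)"
    using s by (rule product_prob_space_normal)
  interpret L: product_sigma_finite "\<lambda>j::nat. lborel :: real measure"
    by (simp add: product_sigma_finite_def lborel.sigma_finite_measure_axioms)
  let ?f = "\<lambda>y. ennreal (\<Prod>j\<in>{1..n}. normal_density (c j) s (y j))"
  let ?P = "density (\<Pi>\<^sub>M j\<in>{1..n}. lborel) ?f"
  have [measurable]: "?f \<in> borel_measurable (\<Pi>\<^sub>M j\<in>{1..n}. lborel)" by measurable
  have "?P = (\<Pi>\<^sub>M j\<in>{1..n}. density lborel (normal_density (c j) s))"
  proof (rule N.PiM_eqI)
    show "sets ?P = sets (\<Pi>\<^sub>M j\<in>{1..n}. density lborel (normal_density (c j) s))"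
      by (simp, intro sets_PiM_cong) auto
    fix A assume "\<And>i. i \<in> {1..n} \<Longrightarrow> A i \<in> sets (density lborel (normal_density (c i) s))"
    then have A: "A i \<in> sets borel" if "i \<in> {1..n}" for i using that by auto
    have box: "Pi\<^sub>E {1..n} A \<in> sets (\<Pi>\<^sub>M j\<in>{1..n}. lborel)"
      by (intro sets_PiM_I_finite) (auto simp: A)
    have "emeasure ?P (Pi\<^sub>E {1..n} A) =
        (\<integral>\<^sup>+y. ?f y * indicator (Pi\<^sub>E {1..n} A) y \<partial>(\<Pi>\<^sub>M j\<in>{1..n}. lborel))"
      by (intro emeasure_density box) measurable
    also have "\<dots> = (\<integral>\<^sup>+y. (\<Prod>j\<in>{1..n}. ennreal (normal_density (c j) s (y j)) * indicator (A j) (y j))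
        \<partial>(\<Pi>\<^sub>M j\<in>{1..n}. lborel))"
    proof (intro nn_integral_cong)
      fix y :: "nat \<Rightarrow> real" assume y: "y \<in> space (\<Pi>\<^sub>M j\<in>{1..n}. lborel)"
      have "indicator (Pi\<^sub>E {1..n} A) y = (\<Prod>j\<in>{1..n}. indicator (A j) (y j) :: ennreal)"
      proof (cases "y \<in> Pi\<^sub>E {1..n} A")
        case True then show ?thesis by (auto simp: PiE_iff intro!: prod.neutral)
      next
        case False
        \<comment> \<open>Points of the product space are extensional, so leaving the box means
          leaving some \<open>A j\<close>.\<close>
        then obtain j where "j \<in> {1..n}" "y j \<notin> A j" using y by (auto simp: space_PiM PiE_iff)
        then have "(\<Prod>j\<in>{1..n}. indicator (A j) (y j) :: ennreal) = 0"
          by (intro prod_zero bexI[of _ j]) (auto simp: indicator_def)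
        then show ?thesis using False by simp
      qed
      then show "?f y * indicator (Pi\<^sub>E {1..n} A) y =
          (\<Prod>j\<in>{1..n}. ennreal (normal_density (c j) s (y j)) * indicator (A j) (y j))"
        by (simp add: prod.distrib prod_ennreal)
    qed
    also have "\<dots> = (\<Prod>j\<in>{1..n}. \<integral>\<^sup>+x. ennreal (normal_density (c j) s x) * indicator (A j) x \<partial>lborel)"
      by (intro L.product_nn_integral_prod)
         (auto intro!: borel_measurable_times_ennreal borel_measurable_indicator A)
    also have "\<dots> = (\<Prod>j\<in>{1..n}. emeasure (density lborel (normal_density (c j) s)) (A j))"
      by (intro prod.cong refl) (auto simp: emeasure_density A)
    finally show "emeasure ?P (Pi\<^sub>E {1..n} A) =
        (\<Prod>j\<in>{1..n}. emeasure (density lborel (normal_density (c j) s)) (A j))" .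
  qed simp
  then show ?thesis unfolding gauss_def by simp
qed

section \<open>Translations, exponential moments and tails of Gaussian measures\<close>

lemma distr_normal_density_shift:
  assumes "s > 0"
  shows "distr (density lborel (normal_density 0 s)) borel (\<lambda>x. c + x) = density lborel (normal_density c s)"
proof -
  interpret prob_space "density lborel (normal_density 0 s)"
    using assms by (rule prob_space_normal_density)
  have "distributed (density lborel (normal_density 0 s)) lborel (\<lambda>x. x) (normal_density 0 s)"
    by (auto simp: distributed_def intro!: measure_eqI simp: emeasure_distr)
  from normal_density_affine[OF this assms, of 1 c] show ?thesis
    by (simp add: distributed_def cong: distr_cong)
qed

text \<open>The preimage of a box under a translation is a box, so the one-dimensional shift applies
  in each factor. Events of the channel output thereby become events of centred noise.\<close>

lemma distr_gauss_shift:
  assumes s: "s > 0"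
  shows "distr (gauss n (\<lambda>_. 0) s) (vec_space n) (\<lambda>z. \<lambda>j\<in>{1..n}. c j + z j) = gauss n c s"
proof -
  interpret N: product_prob_space "\<lambda>j. density lborel (normal_density (c j) s)"
    using s by (rule product_prob_space_normal)
  interpret Z: product_prob_space "\<lambda>j::nat. density lborel (normal_density 0 s)"
    using s by (rule product_prob_space_normal)
  let ?h = "\<lambda>z. \<lambda>j\<in>{1..n}. c j + z j"
  have h [measurable]: "?h \<in> gauss n (\<lambda>_. 0) s \<rightarrow>\<^sub>M vec_space n"
    by measurable
  show ?thesis
    unfolding gauss_def[of n c]
  proof (rule N.PiM_eqI)
    show "sets (distr (gauss n (\<lambda>_. 0) s) (vec_space n) ?h) =
        sets (\<Pi>\<^sub>M j\<in>{1..n}. density lborel (normal_density (c j) s))"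
      by (simp, intro sets_PiM_cong) auto
    fix A assume "\<And>i. i \<in> {1..n} \<Longrightarrow> A i \<in> sets (density lborel (normal_density (c i) s))"
    then have A: "A i \<in> sets borel" if "i \<in> {1..n}" for i using that by auto
    have pre: "(\<lambda>x. c j + x) -` A j \<in> sets borel" if "j \<in> {1..n}" for j
      using measurable_sets[of "\<lambda>x. c j + x" borel borel "A j"] A[OF that] by simp
    have box: "Pi\<^sub>E {1..n} A \<in> sets (vec_space n)"
      by (intro sets_PiM_I_finite) (auto simp: A)
    have "emeasure (distr (gauss n (\<lambda>_. 0) s) (vec_space n) ?h) (Pi\<^sub>E {1..n} A) =
        emeasure (gauss n (\<lambda>_. 0) s) (?h -` Pi\<^sub>E {1..n} A \<inter> space (gauss n (\<lambda>_. 0) s))"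
      by (intro emeasure_distr box h)
    also have "?h -` Pi\<^sub>E {1..n} A \<inter> space (gauss n (\<lambda>_. 0) s) = (\<Pi>\<^sub>E j\<in>{1..n}. (\<lambda>x. c j + x) -` A j)"
      by (auto simp: space_PiM PiE_iff)
    also have "emeasure (gauss n (\<lambda>_. 0) s) \<dots> =
        (\<Prod>j\<in>{1..n}. emeasure (density lborel (normal_density 0 s)) ((\<lambda>x. c j + x) -` A j))"
      unfolding gauss_def by (rule Z.emeasure_PiM) (use pre in auto)
    also have "\<dots> = (\<Prod>j\<in>{1..n}. emeasure (density lborel (normal_density (c j) s)) (A j))"
    proof (intro prod.cong refl)
      fix j assume "j \<in> {1..n}"
      then show "emeasure (density lborel (normal_density 0 s)) ((\<lambda>x. c j + x) -` A j) =
          emeasure (density lborel (normal_density (c j) s)) (A j)"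
        using A unfolding distr_normal_density_shift[OF s, of "c j", symmetric]
        by (simp add: emeasure_distr)
    qed
    finally show "emeasure (distr (gauss n (\<lambda>_. 0) s) (vec_space n) ?h) (Pi\<^sub>E {1..n} A) =
        (\<Prod>j\<in>{1..n}. emeasure (density lborel (normal_density (c j) s)) (A j))" .
  qed simp
qed

text \<open>Completing the square: \<open>normal_density 0 s x * exp (a * x)\<close> is a constant
  times the normal density with mean \<open>s\<^sup>2 * a\<close>.\<close>

lemma nn_integral_normal_exp:
  assumes s: "s > 0"
  shows "(\<integral>\<^sup>+x. ennreal (exp (a * x)) \<partial>density lborel (normal_density 0 s)) = ennreal (exp (s\<^sup>2 * a\<^sup>2 / 2))"
proof -
  have eq: "normal_density 0 s x * exp (a * x) = exp (s\<^sup>2 * a\<^sup>2 / 2) * normal_density (s\<^sup>2 * a) s x" for x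
  proof -
    have "- x\<^sup>2 / (2 * s\<^sup>2) + a * x = s\<^sup>2 * a\<^sup>2 / 2 + - (x - s\<^sup>2 * a)\<^sup>2 / (2 * s\<^sup>2)"
      using s by (simp add: field_simps power2_eq_square)
    then have "exp (- x\<^sup>2 / (2 * s\<^sup>2)) * exp (a * x) = exp (s\<^sup>2 * a\<^sup>2 / 2) * exp (- (x - s\<^sup>2 * a)\<^sup>2 / (2 * s\<^sup>2))"
      by (simp only: exp_add[symmetric])
    then show ?thesis by (simp add: normal_density_def)
  qed
  have "(\<integral>\<^sup>+x. ennreal (exp (a * x)) \<partial>density lborel (normal_density 0 s)) =
      (\<integral>\<^sup>+x. ennreal (exp (s\<^sup>2 * a\<^sup>2 / 2)) * ennreal (normal_density (s\<^sup>2 * a) s x) \<partial>lborel)"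
    by (subst nn_integral_density) (auto simp: ennreal_mult[symmetric] eq)
  also have "\<dots> = ennreal (exp (s\<^sup>2 * a\<^sup>2 / 2)) * (\<integral>\<^sup>+x. ennreal (normal_density (s\<^sup>2 * a) s x) \<partial>lborel)"
    by (rule nn_integral_cmult) simp
  also have "(\<integral>\<^sup>+x. ennreal (normal_density (s\<^sup>2 * a) s x) \<partial>lborel) = 1"
    using s by (simp add: nn_integral_eq_integral)
  finally show ?thesis by simp
qed

lemma nn_integral_gauss_exp:
  assumes s: "s > 0"
  shows "(\<integral>\<^sup>+z. ennreal (exp (\<Sum>j\<in>{1..n}. a j * z j)) \<partial>gauss n (\<lambda>_. 0) s) =
         ennreal (exp (s\<^sup>2 * (\<Sum>j\<in>{1..n}. (a j)\<^sup>2) / 2))"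
proof -
  interpret Z: product_prob_space "\<lambda>j::nat. density lborel (normal_density 0 s)"
    using s by (rule product_prob_space_normal)
  have "(\<integral>\<^sup>+z. ennreal (exp (\<Sum>j\<in>{1..n}. a j * z j)) \<partial>gauss n (\<lambda>_. 0) s) =
      (\<integral>\<^sup>+z. (\<Prod>j\<in>{1..n}. ennreal (exp (a j * z j))) \<partial>gauss n (\<lambda>_. 0) s)"
    by (simp add: exp_sum prod_ennreal)
  also have "\<dots> = (\<Prod>j\<in>{1..n}. ennreal (exp (s\<^sup>2 * (a j)\<^sup>2 / 2)))"
    unfolding gauss_def
    by (subst Z.product_nn_integral_prod) (auto simp: nn_integral_normal_exp[OF s])
  also have "\<dots> = ennreal (exp (s\<^sup>2 * (\<Sum>j\<in>{1..n}. (a j)\<^sup>2) / 2))"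
    by (simp add: exp_sum[symmetric] prod_ennreal sum_distrib_left sum_divide_distrib)
  finally show ?thesis .
qed

text \<open>Markov's inequality for the exponential of the linear form. No tilting parameter appears
  because scaling \<open>a\<close> and \<open>\<theta>\<close> together has the same effect.\<close>

lemma gauss_chernoff:
  assumes s: "s > 0"
  shows "measure (gauss n (\<lambda>_. 0) s) {z \<in> space (gauss n (\<lambda>_. 0) s). \<theta> \<le> (\<Sum>j\<in>{1..n}. a j * z j)}
         \<le> exp (s\<^sup>2 * (\<Sum>j\<in>{1..n}. (a j)\<^sup>2) / 2 - \<theta>)"
proof -
  interpret prob_space "gauss n (\<lambda>_. 0) s" using s by (rule prob_space_gauss)
  let ?Z = "gauss n (\<lambda>_. 0) s"
  let ?A = "{z \<in> space ?Z. \<theta> \<le> (\<Sum>j\<in>{1..n}. a j * z j)}"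
  have A: "?A \<in> sets ?Z" by measurable
  have "emeasure ?Z ?A = (\<integral>\<^sup>+z. indicator ?A z \<partial>?Z)" using A by simp
  also have "\<dots> \<le> (\<integral>\<^sup>+z. ennreal (exp (-\<theta>)) * ennreal (exp (\<Sum>j\<in>{1..n}. a j * z j)) \<partial>?Z)"
    by (intro nn_integral_mono)
       (auto simp: indicator_def ennreal_mult[symmetric] exp_add[symmetric] simp del: ennreal_1
             simp flip: ennreal_1)
  also have "\<dots> = ennreal (exp (-\<theta>)) * ennreal (exp (s\<^sup>2 * (\<Sum>j\<in>{1..n}. (a j)\<^sup>2) / 2))"
    by (subst nn_integral_cmult) (measurable, simp add: nn_integral_gauss_exp[OF s])
  also have "\<dots> = ennreal (exp (s\<^sup>2 * (\<Sum>j\<in>{1..n}. (a j)\<^sup>2) / 2 - \<theta>))"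
    by (simp add: ennreal_mult[symmetric] exp_add[symmetric])
  finally show ?thesis by (simp add: emeasure_eq_measure)
qed

text \<open>Markov's inequality with mean energy \<open>n * s\<^sup>2\<close>. This weak bound
  suffices because the sum-rate converse only has to keep the tail below a constant, not let it
  vanish.\<close>

lemma gauss_energy_tail:
  assumes s: "s > 0" and r: "r > 0"
  shows "measure (gauss n (\<lambda>_. 0) s) {z \<in> space (gauss n (\<lambda>_. 0) s). r \<le> (\<Sum>j\<in>{1..n}. (z j)\<^sup>2)}
         \<le> real n * s\<^sup>2 / r"
proof -
  interpret prob_space "gauss n (\<lambda>_. 0) s" using s by (rule prob_space_gauss)
  let ?Z = "gauss n (\<lambda>_. 0) s" and ?D = "density lborel (normal_density 0 s)"
  let ?A = "{z \<in> space ?Z. r \<le> (\<Sum>j\<in>{1..n}. (z j)\<^sup>2)}"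
  have A: "?A \<in> sets ?Z" by measurable
  have one: "(\<integral>\<^sup>+x. ennreal (x\<^sup>2) \<partial>?D) = ennreal (s\<^sup>2)"
  proof -
    have "has_bochner_integral lborel (\<lambda>x. normal_density 0 s x * x\<^sup>2) (s\<^sup>2)"
      using normal_moment_even[OF s, of 0 1] by simp
    then have "(\<integral>\<^sup>+x. ennreal (normal_density 0 s x * x\<^sup>2) \<partial>lborel) = ennreal (s\<^sup>2)"
      by (subst nn_integral_eq_integral) (auto simp: has_bochner_integral_iff)
    then show ?thesis by (subst nn_integral_density) (auto simp: ennreal_mult)
  qed
  have comp: "(\<integral>\<^sup>+z. ennreal ((z j)\<^sup>2) \<partial>?Z) = ennreal (s\<^sup>2)" if j: "j \<in> {1..n}" for j
  proof -
    have "distr ?Z ?D (\<lambda>z. z j) = ?D"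
      unfolding gauss_def by (rule distr_PiM_component[OF _ j]) (rule prob_space_normal_density[OF s])
    then have "(\<integral>\<^sup>+x. ennreal (x\<^sup>2) \<partial>?D) = (\<integral>\<^sup>+x. ennreal (x\<^sup>2) \<partial>distr ?Z ?D (\<lambda>z. z j))" by simp
    also have "\<dots> = (\<integral>\<^sup>+z. ennreal ((z j)\<^sup>2) \<partial>?Z)"
    proof (rule nn_integral_distr)
      show "(\<lambda>z. z j) \<in> ?Z \<rightarrow>\<^sub>M ?D" using j by measurable
    qed simp
    finally show ?thesis using one by simp
  qed
  have "emeasure ?Z ?A = (\<integral>\<^sup>+z. indicator ?A z \<partial>?Z)" using A by simp
  also have "\<dots> \<le> (\<integral>\<^sup>+z. ennreal (1 / r) * (\<Sum>j\<in>{1..n}. ennreal ((z j)\<^sup>2)) \<partial>?Z)"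
    using r by (intro nn_integral_mono)
       (auto simp: indicator_def ennreal_mult[symmetric] sum_nonneg field_simps simp del: ennreal_1
             simp flip: ennreal_1)
  also have "\<dots> = ennreal (1 / r) * (\<Sum>j\<in>{1..n}. ennreal (s\<^sup>2))"
    by (subst nn_integral_cmult, measurable, subst nn_integral_sum, measurable)
       (simp add: comp)
  also have "\<dots> = ennreal (real n * s\<^sup>2 / r)"
    using r by (simp add: ennreal_mult[symmetric] ennreal_of_nat_eq_real_of_nat)
  finally show ?thesis using r by (simp add: emeasure_eq_measure)
qed

text \<open>Domination of the densities is demanded only on \<open>A\<close>, so that
  \<open>A\<close> can first be cut down to an event where the likelihood ratio is under
  control.\<close>

lemma gauss_change_of_measure:
  assumes s: "s > 0" "s' > 0" and C: "C \<ge> 0" and A: "A \<in> sets (vec_space n)"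
    and le: "\<And>y. y \<in> A \<Longrightarrow>
      (\<Prod>j\<in>{1..n}. normal_density (c j) s (y j)) \<le> C * (\<Prod>j\<in>{1..n}. normal_density (c' j) s' (y j))"
  shows "measure (gauss n c s) A \<le> C * measure (gauss n c' s') A"
proof -
  interpret P: prob_space "gauss n c s" using s by (intro prob_space_gauss)
  interpret Q: prob_space "gauss n c' s'" using s by (intro prob_space_gauss)
  let ?L = "\<Pi>\<^sub>M j\<in>{1..n}. (lborel :: real measure)"
  have [measurable_cong]: "sets ?L = sets (vec_space n)"
    by (intro sets_PiM_cong) auto
  have A': "A \<in> sets ?L" using A by (simp cong: sets_PiM_cong)
  have "emeasure (gauss n c s) A =
      (\<integral>\<^sup>+y. ennreal (\<Prod>j\<in>{1..n}. normal_density (c j) s (y j)) * indicator A y \<partial>?L)"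
    unfolding gauss_eq_density[OF s(1)] by (intro emeasure_density A') measurable
  also have "\<dots> \<le> (\<integral>\<^sup>+y. ennreal C * (ennreal (\<Prod>j\<in>{1..n}. normal_density (c' j) s' (y j)) * indicator A y) \<partial>?L)"
    using C by (intro nn_integral_mono)
      (auto simp: indicator_def ennreal_mult[symmetric] prod_nonneg simp del: prod_ennreal intro!: ennreal_leI le)
  also have "\<dots> = ennreal C * emeasure (gauss n c' s') A"
    unfolding gauss_eq_density[OF s(2)] using A'
    by (subst nn_integral_cmult, measurable) (subst emeasure_density, auto)
  finally show ?thesis
    using C by (simp add: P.emeasure_eq_measure Q.emeasure_eq_measure ennreal_mult[symmetric])
qed

lemma measure_gauss_shift:
  assumes s: "s > 0" and A: "A \<in> sets (vec_space n)"
  shows "measure (gauss n c s) A =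
    measure (gauss n (\<lambda>_. 0) s) {z \<in> space (gauss n (\<lambda>_. 0) s). (\<lambda>j\<in>{1..n}. c j + z j) \<in> A}"
proof -
  have "measure (distr (gauss n (\<lambda>_. 0) s) (vec_space n) (\<lambda>z. \<lambda>j\<in>{1..n}. c j + z j)) A =
      measure (gauss n (\<lambda>_. 0) s)
        ((\<lambda>z. \<lambda>j\<in>{1..n}. c j + z j) -` A \<inter> space (gauss n (\<lambda>_. 0) s))"
    by (intro measure_distr A) measurable
  then show ?thesis
    unfolding distr_gauss_shift[OF s] by (simp add: vimage_def Int_def conj_commute)
qed

section \<open>Hypothesis testing and the error probability\<close>

text \<open>\<open>B\<close> is split according to whether the log-likelihood ratio exceeds
  \<open>\<gamma>\<close>. Below it, passing to the reference costs a factor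
  \<open>exp \<gamma>\<close>. Above it, the Chernoff bound with parameter \<open>r\<close> applies:
  under \<open>c\<close> the ratio is Gaussian with mean \<open>d / (2 * s\<^sup>2)\<close> and
  variance \<open>d / s\<^sup>2\<close>, where \<open>d\<close> is the squared distance of the
  centres.\<close>

lemma gauss_hypothesis_bound:
  assumes s: "s > 0" and B: "B \<in> sets (vec_space n)"
    and D: "(\<Sum>j\<in>{1..n}. (c j - c0 j)\<^sup>2) \<le> D" and r: "r > 0"
  shows "measure (gauss n c s) B \<le>
    exp \<gamma> * measure (gauss n c0 s) B + exp ((r\<^sup>2 + r) * D / (2 * s\<^sup>2) - r * \<gamma>)"
proof -
  interpret P: prob_space "gauss n c s" using s by (intro prob_space_gauss)
  interpret Q: prob_space "gauss n c0 s" using s by (intro prob_space_gauss)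
  interpret Z: prob_space "gauss n (\<lambda>_. 0) s" using s by (intro prob_space_gauss)
  define llr where "llr y = (\<Sum>j\<in>{1..n}. ((y j - c0 j)\<^sup>2 - (y j - c j)\<^sup>2) / (2 * s\<^sup>2))" for y :: "nat \<Rightarrow> real"
  define d where "d = (\<Sum>j\<in>{1..n}. (c j - c0 j)\<^sup>2)"
  have [measurable]: "llr \<in> borel_measurable (vec_space n)"
    unfolding llr_def by measurable
  define G where "G = {y \<in> space (vec_space n). llr y \<le> \<gamma>}"
  have G [measurable]: "G \<in> sets (vec_space n)" unfolding G_def by measurable
  let ?G' = "{y \<in> space (vec_space n). \<gamma> < llr y}"
  have G': "?G' \<in> sets (vec_space n)" by measurable
  have "measure (gauss n c s) B \<le> measure (gauss n c s) ((B \<inter> G) \<union> ?G')"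
    using B G G' sets.sets_into_space[OF B]
    by (intro P.finite_measure_mono) (auto simp: G_def not_le)
  also have "\<dots> \<le> measure (gauss n c s) (B \<inter> G) + measure (gauss n c s) ?G'"
    using B G G' by (intro measure_Un_le) auto
  also have "measure (gauss n c s) (B \<inter> G) \<le> exp \<gamma> * measure (gauss n c0 s) (B \<inter> G)"
  proof (intro gauss_change_of_measure s)
    fix y assume y: "y \<in> B \<inter> G"
    have "normal_density (c j) s (y j) =
        exp (((y j - c0 j)\<^sup>2 - (y j - c j)\<^sup>2) / (2 * s\<^sup>2)) * normal_density (c0 j) s (y j)" for j
    proof -
      have "exp (- (y j - c j)\<^sup>2 / (2 * s\<^sup>2)) =
          exp (((y j - c0 j)\<^sup>2 - (y j - c j)\<^sup>2) / (2 * s\<^sup>2)) * exp (- (y j - c0 j)\<^sup>2 / (2 * s\<^sup>2))"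
        by (simp only: exp_add[symmetric]) (simp add: diff_divide_distrib)
      then show ?thesis by (simp add: normal_density_def)
    qed
    then have "(\<Prod>j\<in>{1..n}. normal_density (c j) s (y j)) =
        exp (llr y) * (\<Prod>j\<in>{1..n}. normal_density (c0 j) s (y j))"
      by (simp add: llr_def exp_sum prod.distrib)
    also have "\<dots> \<le> exp \<gamma> * (\<Prod>j\<in>{1..n}. normal_density (c0 j) s (y j))"
      using y by (intro mult_right_mono prod_nonneg) (auto simp: G_def)
    finally show "(\<Prod>j\<in>{1..n}. normal_density (c j) s (y j)) \<le>
        exp \<gamma> * (\<Prod>j\<in>{1..n}. normal_density (c0 j) s (y j))" .
  qed (use B G in auto)
  also have "measure (gauss n c0 s) (B \<inter> G) \<le> measure (gauss n c0 s) B"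
    using B by (intro Q.finite_measure_mono) auto
  also have "measure (gauss n c s) ?G' \<le> exp ((r\<^sup>2 + r) * D / (2 * s\<^sup>2) - r * \<gamma>)"
  proof -
    \<comment> \<open>\<open>?a\<close> is \<open>r\<close> times the noise coefficients of the
      ratio; \<open>?\<theta>\<close> is \<open>r\<close> times what remains of the threshold once
      the mean is subtracted.\<close>
    let ?a = "\<lambda>j. r * (c j - c0 j) / s\<^sup>2" and ?\<theta> = "r * (\<gamma> - d / (2 * s\<^sup>2))"
    have "measure (gauss n c s) ?G' =
        measure (gauss n (\<lambda>_. 0) s) {z \<in> space (gauss n (\<lambda>_. 0) s). (\<lambda>j\<in>{1..n}. c j + z j) \<in> ?G'}"
      by (rule measure_gauss_shift[OF s G'])
    also have "\<dots> \<le> measure (gauss n (\<lambda>_. 0) s)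
        {z \<in> space (gauss n (\<lambda>_. 0) s). ?\<theta> \<le> (\<Sum>j\<in>{1..n}. ?a j * z j)}"
    proof (intro Z.finite_measure_mono)
      have "?\<theta> \<le> (\<Sum>j\<in>{1..n}. ?a j * z j)" if "\<gamma> < llr (\<lambda>j\<in>{1..n}. c j + z j)" for z
      proof -
        have "r * llr (\<lambda>j\<in>{1..n}. c j + z j) =
            (\<Sum>j\<in>{1..n}. ?a j * z j + r * ((c j - c0 j)\<^sup>2 / (2 * s\<^sup>2)))"
          unfolding llr_def sum_distrib_left
          using s by (intro sum.cong) (auto simp: field_simps power2_eq_square)
        also have "\<dots> = (\<Sum>j\<in>{1..n}. ?a j * z j) + r * (d / (2 * s\<^sup>2))"
          unfolding d_def by (simp add: sum.distrib sum_distrib_left sum_divide_distrib)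
        finally show ?thesis
          using mult_strict_left_mono[OF that r] by (simp add: algebra_simps)
      qed
      then show "{z \<in> space (gauss n (\<lambda>_. 0) s). (\<lambda>j\<in>{1..n}. c j + z j) \<in> ?G'} \<subseteq>
          {z \<in> space (gauss n (\<lambda>_. 0) s). ?\<theta> \<le> (\<Sum>j\<in>{1..n}. ?a j * z j)}"
        by auto
    qed measurable
    also have "\<dots> \<le> exp (s\<^sup>2 * (\<Sum>j\<in>{1..n}. (?a j)\<^sup>2) / 2 - ?\<theta>)"
      by (rule gauss_chernoff[OF s])
    also have "(\<Sum>j\<in>{1..n}. (?a j)\<^sup>2) = r\<^sup>2 / s ^ 4 * d"
      unfolding d_def sum_distrib_left
      by (intro sum.cong refl) (simp add: power_divide power_mult_distrib power_mult[symmetric])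
    also have "s\<^sup>2 * (r\<^sup>2 / s ^ 4 * d) / 2 - ?\<theta> = (r\<^sup>2 + r) * d / (2 * s\<^sup>2) - r * \<gamma>"
      using s by (simp add: field_simps power2_eq_square power4_eq_xxxx)
    also have "\<dots> \<le> (r\<^sup>2 + r) * D / (2 * s\<^sup>2) - r * \<gamma>"
      using D r by (intro diff_mono divide_right_mono mult_left_mono) (auto simp: d_def)
    finally show ?thesis by simp
  qed
  finally show ?thesis by simp
qed

lemma sum_disjoint_measure_le:
  assumes "prob_space P" "finite T" "\<And>t. t \<in> T \<Longrightarrow> B t \<in> sets P" "disjoint_family_on B T"
  shows "(\<Sum>t\<in>T. measure P (B t)) \<le> 1"
proof -
  interpret prob_space P by fact
  have "(\<Sum>t\<in>T. measure P (B t)) = measure P (\<Union>t\<in>T. B t)"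
    using assms by (intro finite_measure_finite_Union[symmetric]) auto
  then show ?thesis by simp
qed

text \<open>Disjoint regions share a reference mass of at most one, so the factor
  \<open>exp \<gamma>\<close> is paid once and not once per hypothesis.\<close>

lemma gauss_multihypothesis_bound:
  assumes s: "s > 0" and T: "finite T" and B: "\<And>t. t \<in> T \<Longrightarrow> B t \<in> sets (vec_space n)"
    and disj: "disjoint_family_on B T"
    and D: "\<And>t. t \<in> T \<Longrightarrow> (\<Sum>j\<in>{1..n}. (c t j - c0 j)\<^sup>2) \<le> D" and r: "r > 0"
  shows "(\<Sum>t\<in>T. measure (gauss n (c t) s) (B t)) \<le>
    exp \<gamma> + real (card T) * exp ((r\<^sup>2 + r) * D / (2 * s\<^sup>2) - r * \<gamma>)"
proof -
  have "(\<Sum>t\<in>T. measure (gauss n (c t) s) (B t)) \<le>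
      (\<Sum>t\<in>T. exp \<gamma> * measure (gauss n c0 s) (B t) + exp ((r\<^sup>2 + r) * D / (2 * s\<^sup>2) - r * \<gamma>))"
    by (intro sum_mono gauss_hypothesis_bound s B D r)
  also have "\<dots> = exp \<gamma> * (\<Sum>t\<in>T. measure (gauss n c0 s) (B t)) +
      real (card T) * exp ((r\<^sup>2 + r) * D / (2 * s\<^sup>2) - r * \<gamma>)"
    by (simp add: sum.distrib sum_distrib_left)
  also have "(\<Sum>t\<in>T. measure (gauss n c0 s) (B t)) \<le> 1"
    using B by (intro sum_disjoint_measure_le prob_space_gauss s T disj) auto
  finally show ?thesis by simp
qed

section \<open>The error probability as an average of Gaussian measures\<close>

definition superposition :: "(nat \<Rightarrow> nat \<Rightarrow> nat \<Rightarrow> real) \<Rightarrow> nat \<Rightarrow> (nat \<Rightarrow> nat) \<Rightarrow> nat \<Rightarrow> real" where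
  "superposition x K w j = (\<Sum>i=1..K. x i (w i) j)"

lemma channel_output_eq: "channel_output K n x w z = (\<lambda>j\<in>{1..n}. superposition x K w j + z j)"
  by (simp add: channel_output_def superposition_def)

lemma decoding_region_measurable:
  assumes "d \<in> decoders K n M" and w: "w \<in> {1..K} \<rightarrow>\<^sub>E {1..M}"
  shows "{y \<in> space (vec_space n). d y = w} \<in> sets (vec_space n)"
proof -
  have "d -` {w} \<inter> space (vec_space n) \<in> sets (vec_space n)"
    using assms unfolding decoders_def by (intro measurable_sets[of d]) auto
  then show ?thesis by (simp add: vimage_def Int_def conj_commute)
qed

lemma emeasure_message_space_singleton:
  assumes M: "M \<ge> 1" and w: "w \<in> {1..K} \<rightarrow>\<^sub>E {1..M}"
  shows "emeasure (message_space K M) {w} = ennreal (1 / real M ^ K)" "{w} \<in> sets (message_space K M)"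
proof -
  interpret product_prob_space "\<lambda>_::nat. uniform_count_measure {1..M}"
    using M by (auto simp: product_prob_space_def product_prob_space_axioms_def product_sigma_finite_def
      intro!: prob_space_imp_sigma_finite prob_space_uniform_count_measure)
  have eq: "{w} = Pi\<^sub>E {1..K} (\<lambda>i. {w i})"
    using w by (intro PiE_singleton[symmetric]) (simp add: PiE_iff)
  have wi: "w i \<in> {1..M}" if "i \<in> {1..K}" for i using w that by auto
  show "{w} \<in> sets (message_space K M)"
    unfolding message_space_def eq using w
    by (intro sets_PiM_I_finite) (auto simp: sets_uniform_count_measure)
  have "emeasure (message_space K M) (Pi\<^sub>E {1..K} (\<lambda>i. {w i})) =
      (\<Prod>i\<in>{1..K}. emeasure (uniform_count_measure {1..M}) {w i})"
    unfolding message_space_def using wi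
    by (intro emeasure_PiM) (auto simp: sets_uniform_count_measure)
  also have "\<dots> = (\<Prod>i\<in>{1..K}. ennreal (1 / real M))"
    using wi by (intro prod.cong refl) (subst emeasure_uniform_count_measure, auto)
  also have "\<dots> = ennreal (1 / real M ^ K)"
    by (simp add: ennreal_power power_divide)
  finally show "emeasure (message_space K M) {w} = ennreal (1 / real M ^ K)"
    by (simp only: eq[symmetric])
qed

text \<open>The error event is sliced over the finitely many tuples \<open>w\<close>, each of
  probability \<open>1 / M ^ K\<close>, and the noise in each slice is translated. The converses and
  the block code work with this average instead of the product space.\<close>

lemma joint_error_prob_eq:
  assumes N0: "N0 > 0" and M: "M \<ge> 1" and d: "d \<in> decoders K n M"
  shows "joint_error_prob N0 K n M x d =
    (\<Sum>w\<in>{1..K} \<rightarrow>\<^sub>E {1..M}. measure (gauss n (superposition x K w) (sqrt (N0 / 2)))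
      {y \<in> space (vec_space n). d y \<noteq> w}) / real M ^ K"
proof -
  let ?W = "{1..K} \<rightarrow>\<^sub>E {1..M}" and ?N = "noise_space N0 n" and ?s = "sqrt (N0 / 2)"
  let ?P = "message_space K M \<Otimes>\<^sub>M ?N"
  have s: "?s > 0" using N0 by simp
  interpret PP: prob_space ?P using N0 M by (rule prob_space_message_noise)
  interpret N: prob_space ?N unfolding noise_space_eq_gauss using s by (rule prob_space_gauss)
  define E where "E w = {z \<in> space ?N. channel_output K n x w z \<in> {y \<in> space (vec_space n). d y \<noteq> w}}" for w
  have R: "{y \<in> space (vec_space n). d y \<noteq> w} \<in> sets (vec_space n)" if "w \<in> ?W" for w
  proof -
    have "{y \<in> space (vec_space n). d y \<noteq> w} = space (vec_space n) - {y \<in> space (vec_space n). d y = w}"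
      by auto
    then show ?thesis using sets.compl_sets[OF decoding_region_measurable[OF d that]] by simp
  qed
  have E: "E w \<in> sets ?N" if "w \<in> ?W" for w
  proof -
    have "channel_output K n x w \<in> ?N \<rightarrow>\<^sub>M vec_space n"
      unfolding channel_output_eq noise_space_eq_gauss by measurable
    from measurable_sets[OF this R[OF that]] show ?thesis
      by (simp add: E_def vimage_def Int_def conj_commute)
  qed
  have sp: "space (message_space K M) = ?W"
    by (simp add: message_space_def space_PiM space_uniform_count_measure)
  have "channel_output K n x w z \<in> space (vec_space n)" for w z
    by (simp add: channel_output_eq space_PiM)
  then have "{(w, z) \<in> space ?P. d (channel_output K n x w z) \<noteq> w} =
      (\<Union>w\<in>?W. {w} \<times> E w)"
    by (auto simp: space_pair_measure sp E_def)
  then have "joint_error_prob N0 K n M x d = measure ?P (\<Union>w\<in>?W. {w} \<times> E w)"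
    by (simp only: joint_error_prob_def)
  also have "\<dots> = (\<Sum>w\<in>?W. measure ?P ({w} \<times> E w))"
  proof (intro PP.finite_measure_finite_Union)
    show "finite ?W" by (intro finite_PiE) auto
    show "(\<lambda>w. {w} \<times> E w) ` ?W \<subseteq> sets ?P"
      using emeasure_message_space_singleton(2)[OF M] E by auto
  qed (auto simp: disjoint_family_on_def)
  also have "\<dots> = (\<Sum>w\<in>?W. measure ?N (E w) / real M ^ K)"
  proof (intro sum.cong refl)
    fix w assume w: "w \<in> ?W"
    have "emeasure ?P ({w} \<times> E w) = ennreal (1 / real M ^ K) * emeasure ?N (E w)"
      using emeasure_message_space_singleton[OF M w] E[OF w]
      by (subst N.emeasure_pair_measure_Times) auto
    also have "\<dots> = ennreal (measure ?N (E w) / real M ^ K)"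
      by (simp add: N.emeasure_eq_measure ennreal_mult[symmetric])
    finally show "measure ?P ({w} \<times> E w) = measure ?N (E w) / real M ^ K"
      by (simp add: measure_def)
  qed
  also have "\<dots> = (\<Sum>w\<in>?W. measure (gauss n (superposition x K w) ?s)
      {y \<in> space (vec_space n). d y \<noteq> w} / real M ^ K)"
    by (intro sum.cong refl)
       (simp only: measure_gauss_shift[OF s R] E_def noise_space_eq_gauss channel_output_eq)
  finally show ?thesis by (simp add: sum_divide_distrib)
qed

lemma symmetric_code_correct_sum:
  assumes N0: "N0 > 0" and M: "M \<ge> 1" and code: "symmetric_code N0 K n M E \<epsilon> x d"
  shows "(1 - \<epsilon>) * real M ^ K \<le>
    (\<Sum>w\<in>{1..K} \<rightarrow>\<^sub>E {1..M}. measure (gauss n (superposition x K w) (sqrt (N0 / 2)))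
      {y \<in> space (vec_space n). d y = w})"
proof -
  let ?W = "{1..K} \<rightarrow>\<^sub>E {1..M}" and ?s = "sqrt (N0 / 2)"
  let ?p = "\<lambda>w. measure (gauss n (superposition x K w) ?s) {y \<in> space (vec_space n). d y = w}"
  have s: "?s > 0" using N0 by simp
  have d: "d \<in> decoders K n M" and err: "joint_error_prob N0 K n M x d \<le> \<epsilon>"
    using code by (auto simp: symmetric_code_def)
  have compl: "measure (gauss n (superposition x K w) ?s) {y \<in> space (vec_space n). d y \<noteq> w} = 1 - ?p w"
    if "w \<in> ?W" for w
  proof -
    interpret prob_space "gauss n (superposition x K w) ?s" using s by (rule prob_space_gauss)
    have "{y \<in> space (vec_space n). d y \<noteq> w} =
        space (gauss n (superposition x K w) ?s) - {y \<in> space (vec_space n). d y = w}" by auto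
    then show ?thesis using prob_compl[of "{y \<in> space (vec_space n). d y = w}"]
      decoding_region_measurable[OF d that] by simp
  qed
  have card: "card ?W = M ^ K" by (simp add: card_PiE)
  have "(\<Sum>w\<in>?W. 1 - ?p w) / real M ^ K \<le> \<epsilon>"
    using err unfolding joint_error_prob_eq[OF N0 M d] by (simp add: compl cong: sum.cong)
  then have "(\<Sum>w\<in>?W. 1 - ?p w) \<le> \<epsilon> * real M ^ K"
    using M by (simp add: divide_le_eq)
  then show ?thesis
    by (simp add: sum_subtractf card algebra_simps)
qed

section \<open>Converse bounds\<close>

text \<open>For fixed \<open>w\<close> the tuples \<open>\<tau> t w\<close> form a multihypothesis
  test around \<open>ctr w\<close>. Since each \<open>\<tau> t\<close> permutes the message tuples,
  summing the success probabilities at \<open>\<tau> t w\<close> over \<open>w\<close> gives back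
  the total success probability of the code. Hence the average error controls these tests, although
  no particular \<open>w\<close> need be decoded well.\<close>

lemma converse_hypotheses:
  fixes N0 \<epsilon> r D :: real and \<tau> :: "'t \<Rightarrow> (nat \<Rightarrow> nat) \<Rightarrow> (nat \<Rightarrow> nat)"
  assumes N0: "N0 > 0" and M: "M \<ge> 1" and \<epsilon>: "\<epsilon> < 1" and code: "symmetric_code N0 K n M E \<epsilon> x d"
    and T: "finite T" "T \<noteq> {}" and r: "r > 0"
    and bij: "\<And>t. t \<in> T \<Longrightarrow> bij_betw (\<tau> t) ({1..K} \<rightarrow>\<^sub>E {1..M}) ({1..K} \<rightarrow>\<^sub>E {1..M})"
    and inj: "\<And>w. w \<in> {1..K} \<rightarrow>\<^sub>E {1..M} \<Longrightarrow> inj_on (\<lambda>t. \<tau> t w) T"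
    and D: "\<And>t w. t \<in> T \<Longrightarrow> w \<in> {1..K} \<rightarrow>\<^sub>E {1..M} \<Longrightarrow>
      (\<Sum>j\<in>{1..n}. (superposition x K (\<tau> t w) j - ctr w j)\<^sup>2) \<le> D"
  shows "ln (real (card T)) \<le> (1 + r) * D / N0 + (1 + 1 / r) * ln (2 / (1 - \<epsilon>))"
proof -
  let ?W = "{1..K} \<rightarrow>\<^sub>E {1..M}" and ?s = "sqrt (N0 / 2)"
  let ?B = "\<lambda>w. {y \<in> space (vec_space n). d y = w}"
  define p where "p w = measure (gauss n (superposition x K w) ?s) (?B w)" for w
  define l where "l = ln (2 / (1 - \<epsilon>))"
  \<comment> \<open>Chosen so that the Chernoff term equals
    \<open>exp (- l) = (1 - \<epsilon>) / 2\<close>, half of the guaranteed success probability. The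
    other half must then be covered by \<open>exp \<gamma>\<close>.\<close>
  define \<gamma> where "\<gamma> = (1 + r) * D / N0 + l / r"
  have s: "?s > 0" and s2: "2 * ?s\<^sup>2 = N0" using N0 by auto
  have d: "d \<in> decoders K n M" using code by (simp add: symmetric_code_def)
  have card: "card ?W = M ^ K" by (simp add: card_PiE)
  have expo: "(r\<^sup>2 + r) * D / N0 - r * \<gamma> = - l"
    unfolding \<gamma>_def using r N0 by (simp add: field_simps power2_eq_square)
  have expl: "exp (- l) = (1 - \<epsilon>) / 2"
    unfolding l_def using \<epsilon> by (simp add: exp_minus)
  have step: "(\<Sum>t\<in>T. p (\<tau> t w)) \<le> exp \<gamma> + real (card T) * ((1 - \<epsilon>) / 2)" if w: "w \<in> ?W" for w
  proof -
    have mem: "\<tau> t w \<in> ?W" if "t \<in> T" for t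
      using bij[OF that] w by (auto dest: bij_betwE)
    have "(\<Sum>t\<in>T. p (\<tau> t w)) \<le>
        exp \<gamma> + real (card T) * exp ((r\<^sup>2 + r) * D / (2 * ?s\<^sup>2) - r * \<gamma>)"
      unfolding p_def
    proof (rule gauss_multihypothesis_bound[OF s T(1) _ _ _ r])
      show "disjoint_family_on (\<lambda>t. ?B (\<tau> t w)) T"
        using inj[OF w] by (auto simp: disjoint_family_on_def inj_on_def)
    qed (use D w mem decoding_region_measurable[OF d] in auto)
    then show ?thesis by (simp only: s2 expo expl)
  qed
  have pos: "real M ^ K > 0" using M by simp
  have "real (card T) * ((1 - \<epsilon>) * real M ^ K) \<le> real (card T) * (\<Sum>w\<in>?W. p w)"
    using symmetric_code_correct_sum[OF N0 M code] by (intro mult_left_mono) (auto simp: p_def)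
  also have "\<dots> = (\<Sum>t\<in>T. \<Sum>w\<in>?W. p w)" by simp
  also have "\<dots> = (\<Sum>t\<in>T. \<Sum>w\<in>?W. p (\<tau> t w))"
    by (intro sum.cong refl sum.reindex_bij_betw[symmetric] bij)
  also have "\<dots> = (\<Sum>w\<in>?W. \<Sum>t\<in>T. p (\<tau> t w))" by (rule sum.swap)
  also have "\<dots> \<le> (\<Sum>w\<in>?W. exp \<gamma> + real (card T) * ((1 - \<epsilon>) / 2))"
    by (intro sum_mono step)
  also have "\<dots> = (exp \<gamma> + real (card T) * ((1 - \<epsilon>) / 2)) * real M ^ K"
    by (simp add: card)
  finally have "(real (card T) * (1 - \<epsilon>)) * real M ^ K \<le>
      (exp \<gamma> + real (card T) * ((1 - \<epsilon>) / 2)) * real M ^ K"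
    by (simp only: mult.assoc)
  then have "real (card T) * (1 - \<epsilon>) \<le> exp \<gamma> + real (card T) * ((1 - \<epsilon>) / 2)"
    using pos by (simp only: mult_le_cancel_right_pos)
  then have "real (card T) \<le> exp \<gamma> * (2 / (1 - \<epsilon>))"
    using \<epsilon> by (simp add: field_simps)
  also have "2 / (1 - \<epsilon>) = exp l" unfolding l_def using \<epsilon> by simp
  finally have "real (card T) \<le> exp (\<gamma> + l)" by (simp add: exp_add)
  then have "ln (real (card T)) \<le> \<gamma> + l"
    using T ln_mono[of "real (card T)" "exp (\<gamma> + l)"] by (simp add: card_gt_0_iff)
  then show ?thesis by (simp add: \<gamma>_def l_def algebra_simps)
qed

section \<open>Cyclic rotations of a message\<close>

definition rotate_message :: "nat \<Rightarrow> nat \<Rightarrow> nat \<Rightarrow> nat" where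
  "rotate_message M t m = (m - 1 + t) mod M + 1"

lemma rotate_message_in:
  assumes "M \<ge> 1"
  shows "rotate_message M t m \<in> {1..M}"
proof -
  have "(m - 1 + t) mod M < M" using assms by (intro mod_less_divisor) linarith
  then show ?thesis unfolding rotate_message_def atLeastAtMost_iff by linarith
qed

text \<open>Used in two roles. With \<open>t\<close> the shift it makes one rotation injective in
  the message; with \<open>t\<close> the message, moved to the residues from \<open>0\<close> to
  \<open>M - 1\<close>, it makes the rotations of one message pairwise different.\<close>

lemma mod_add_inj:
  fixes a b t M :: nat
  assumes "(a + t) mod M = (b + t) mod M" "a < M" "b < M" "t < M"
  shows "a = b"
proof -
  have "(c + t) mod M = (if c + t < M then c + t else c + t - M)" if "c < M" for c
    using that assms(4) by (auto simp: mod_if[of "c + t"] le_mod_geq)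
  from this[OF assms(2)] this[OF assms(3)] show ?thesis
    using assms by (auto split: if_splits)
qed

lemma bij_betw_rotate_coordinate:
  fixes i K t M :: nat
  assumes M: "M \<ge> 1" and i: "i \<in> {1..K}" and t: "t < M"
  shows "bij_betw (\<lambda>w. w(i := rotate_message M t (w i))) ({1..K} \<rightarrow>\<^sub>E {1..M}) ({1..K} \<rightarrow>\<^sub>E {1..M})"
proof -
  let ?W = "{1..K} \<rightarrow>\<^sub>E {1..M}" and ?f = "\<lambda>w. w(i := rotate_message M t (w i))"
  have "?f ` ?W \<subseteq> ?W"
    using i rotate_message_in[OF M] by (auto simp: PiE_iff extensional_def)
  moreover have "inj_on ?f ?W"
  proof (rule inj_onI)
    fix w w' assume w: "w \<in> ?W" "w' \<in> ?W" and eq: "?f w = ?f w'"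
    have "rotate_message M t (w i) = rotate_message M t (w' i)"
      using fun_cong[OF eq, of i] by simp
    then have eq_mod: "(w i - 1 + t) mod M = (w' i - 1 + t) mod M"
      unfolding rotate_message_def by (rule add_right_imp_eq)
    have wi: "w i \<ge> 1 \<and> w i \<le> M" "w' i \<ge> 1 \<and> w' i \<le> M"
      using PiE_mem[OF w(1) i] PiE_mem[OF w(2) i] by simp_all
    have "w i - 1 < M" "w' i - 1 < M" using wi by linarith+
    from mod_add_inj[OF eq_mod this t] have "w i - 1 = w' i - 1" .
    then have "w i = w' i" using wi by linarith
    moreover have "w j = w' j" if "j \<noteq> i" for j
      using fun_cong[OF eq, of j] that by simp
    ultimately show "w = w'" by (intro ext) metis
  qed
  moreover have "finite ?W" by (intro finite_PiE) auto
  ultimately show ?thesis unfolding bij_betw_def using endo_inj_surj by blast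
qed

lemma superposition_fun_upd:
  assumes "i \<in> {1..K}"
  shows "superposition x K (w(i := m)) j = superposition x K w j - x i (w i) j + x i m j"
proof -
  have "superposition x K v j = x i (v i) j + (\<Sum>i'\<in>{1..K} - {i}. x i' (v i') j)" for v
    unfolding superposition_def using assms by (intro sum.remove) auto
  moreover have "(\<Sum>i'\<in>{1..K} - {i}. x i' ((w(i := m)) i') j) = (\<Sum>i'\<in>{1..K} - {i}. x i' (w i') j)"
    by (intro sum.cong) auto
  ultimately show ?thesis by simp
qed

text \<open>The message of user 1 is rotated through all \<open>M\<close> values. Around the
  contribution of the other users, the squared distance of a hypothesis is just the energy of one
  codeword. A small \<open>r\<close> brings the slope in \<open>E\<close> close to
  \<open>1 / N0\<close>, at the price of a large additive constant.\<close>

lemma converse_single_user: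
  assumes N0: "N0 > 0" and M: "M \<ge> 1" and \<epsilon>: "\<epsilon> < 1" and code: "symmetric_code N0 K n M E \<epsilon> x d"
    and K: "K \<ge> 1" and r: "r > 0"
  shows "ln (real M) \<le> (1 + r) * E / N0 + (1 + 1 / r) * ln (2 / (1 - \<epsilon>))"
proof -
  let ?\<tau> = "\<lambda>t w. w(1 := rotate_message M t (w 1))"
  have one: "1 \<in> {1..K}" using K by simp
  have "ln (real (card {0..<M})) \<le> (1 + r) * E / N0 + (1 + 1 / r) * ln (2 / (1 - \<epsilon>))"
  proof (rule converse_hypotheses[OF N0 M \<epsilon> code, where \<tau> = ?\<tau> and
        ctr = "\<lambda>w j. superposition x K w j - x 1 (w 1) j"])
    fix w assume w: "w \<in> {1..K} \<rightarrow>\<^sub>E {1..M}"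
    show "inj_on (\<lambda>t. ?\<tau> t w) {0..<M}"
    proof (rule inj_onI)
      fix t t' assume t: "t \<in> {0..<M}" "t' \<in> {0..<M}" and eq: "?\<tau> t w = ?\<tau> t' w"
      have "w 1 \<in> {1..M}" using w one by auto
      then have "w 1 - 1 < M" by auto
      moreover have "rotate_message M t (w 1) = rotate_message M t' (w 1)"
        using fun_cong[OF eq, of 1] by simp
      ultimately show "t = t'"
        using t by (intro mod_add_inj[of t "w 1 - 1" M]) (auto simp: rotate_message_def add.commute)
    qed
    fix t assume "t \<in> {0..<M}"
    show "(\<Sum>j\<in>{1..n}. (superposition x K (?\<tau> t w) j - (superposition x K w j - x 1 (w 1) j))\<^sup>2) \<le> E"
      using code one rotate_message_in[OF M]
      by (auto simp: superposition_fun_upd[OF one] symmetric_code_def)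
  qed (use M r bij_betw_rotate_coordinate[OF M one] in auto)
  then show ?thesis by simp
qed

text \<open>The hypothesis is which user has advanced its message by one. The centre is the
  unperturbed superposition, and the difference of two codewords has energy at most
  \<open>2 * E + 2 * E\<close>; taking \<open>r = 1\<close> then gives
  \<open>8 * E / N0\<close>.\<close>

lemma converse_user_identification:
  assumes N0: "N0 > 0" and M: "M \<ge> 2" and \<epsilon>: "\<epsilon> < 1" and code: "symmetric_code N0 K n M E \<epsilon> x d"
    and K: "K \<ge> 1"
  shows "ln (real K) \<le> 8 * E / N0 + 2 * ln (2 / (1 - \<epsilon>))"
proof -
  let ?\<tau> = "\<lambda>t w. w(t := rotate_message M 1 (w t))"
  have M1: "M \<ge> 1" using M by simp
  have "ln (real (card {1..K})) \<le> (1 + 1) * (4 * E) / N0 + (1 + 1 / 1) * ln (2 / (1 - \<epsilon>))"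
  proof (rule converse_hypotheses[OF N0 M1 \<epsilon> code, where \<tau> = ?\<tau> and ctr = "superposition x K"])
    fix w assume w: "w \<in> {1..K} \<rightarrow>\<^sub>E {1..M}"
    \<comment> \<open>With at least two messages, rotation by one has no fixed point, so changing
      different users gives different tuples.\<close>
    have ne: "rotate_message M 1 m \<noteq> m" if "m \<in> {1..M}" for m
      using that M by (cases "m = M") (auto simp: rotate_message_def)
    show "inj_on (\<lambda>t. ?\<tau> t w) {1..K}"
    proof (rule inj_onI, rule ccontr)
      fix t t' assume t: "t \<in> {1..K}" "t' \<in> {1..K}" "t \<noteq> t'" and eq: "?\<tau> t w = ?\<tau> t' w"
      have "rotate_message M 1 (w t) = w t" using fun_cong[OF eq, of t] t(3) by simp
      then show False using ne PiE_mem[OF w t(1)] by simp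
    qed
    fix t assume t: "t \<in> {1..K}"
    let ?u = "x t (rotate_message M 1 (w t))" and ?v = "x t (w t)"
    have "(\<Sum>j\<in>{1..n}. (superposition x K (?\<tau> t w) j - superposition x K w j)\<^sup>2) =
        (\<Sum>j\<in>{1..n}. (?u j - ?v j)\<^sup>2)"
      by (simp add: superposition_fun_upd[OF t])
    also have "\<dots> \<le> (\<Sum>j\<in>{1..n}. 2 * (?u j)\<^sup>2 + 2 * (?v j)\<^sup>2)"
    proof (intro sum_mono)
      fix j show "(?u j - ?v j)\<^sup>2 \<le> 2 * (?u j)\<^sup>2 + 2 * (?v j)\<^sup>2"
        using zero_le_power2[of "?u j + ?v j"] by (simp add: power2_eq_square algebra_simps)
    qed
    also have "\<dots> = 2 * (\<Sum>j\<in>{1..n}. (?u j)\<^sup>2) + 2 * (\<Sum>j\<in>{1..n}. (?v j)\<^sup>2)"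
      by (simp add: sum.distrib sum_distrib_left)
    also have "\<dots> \<le> 2 * E + 2 * E"
    proof -
      have "w t \<in> {1..M}" using w t by auto
      then show ?thesis using code t rotate_message_in[OF M1]
        unfolding symmetric_code_def by (intro add_mono mult_left_mono) auto
    qed
    finally show "(\<Sum>j\<in>{1..n}. (superposition x K (?\<tau> t w) j - superposition x K w j)\<^sup>2) \<le> 4 * E"
      by simp
  qed (use M K in \<open>auto intro!: bij_betw_rotate_coordinate[OF M1]\<close>)
  then show ?thesis by simp
qed

text \<open>The second moment of a sum of independent centred variables: the cross terms vanish. The
  constant \<open>c\<close> is general because in the induction the value \<open>a i b\<close> of
  the new coordinate joins it.\<close>

lemma sum_PiE_square_zero_mean:
  fixes a :: "'i \<Rightarrow> 'b \<Rightarrow> real"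
  assumes "finite I" "finite S" "S \<noteq> {}" "\<And>i. i \<in> I \<Longrightarrow> (\<Sum>b\<in>S. a i b) = 0"
  shows "(\<Sum>w\<in>I \<rightarrow>\<^sub>E S. (c + (\<Sum>i\<in>I. a i (w i)))\<^sup>2) =
    real (card S) ^ card I * (c\<^sup>2 + (\<Sum>i\<in>I. \<Sum>b\<in>S. (a i b)\<^sup>2) / card S)"
  using assms(1,4)
proof (induction I arbitrary: c rule: finite_induct)
  case empty
  then show ?case by simp
next
  case (insert i I)
  let ?m = "real (card S)"
  let ?V = "(\<Sum>i\<in>I. \<Sum>b\<in>S. (a i b)\<^sup>2) / ?m"
  have m: "?m > 0" using assms by (simp add: card_gt_0_iff)
  have "(\<Sum>w\<in>insert i I \<rightarrow>\<^sub>E S. (c + (\<Sum>i\<in>insert i I. a i (w i)))\<^sup>2) =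
      (\<Sum>(b, w)\<in>S \<times> (I \<rightarrow>\<^sub>E S). (c + (\<Sum>i'\<in>insert i I. a i' ((w(i := b)) i')))\<^sup>2)"
    using insert.hyps unfolding PiE_insert_eq
    by (subst sum.reindex[OF inj_combinator[OF insert.hyps(2)]]) (simp add: case_prod_unfold)
  also have "\<dots> = (\<Sum>b\<in>S. \<Sum>w\<in>I \<rightarrow>\<^sub>E S. ((c + a i b) + (\<Sum>i\<in>I. a i (w i)))\<^sup>2)"
    unfolding sum.cartesian_product[symmetric]
  proof (intro sum.cong refl)
    fix b w
    have "(\<Sum>i'\<in>I. a i' ((w(i := b)) i')) = (\<Sum>i\<in>I. a i (w i))"
      using insert.hyps by (intro sum.cong) auto
    then show "(c + (\<Sum>i'\<in>insert i I. a i' ((w(i := b)) i')))\<^sup>2 = ((c + a i b) + (\<Sum>i\<in>I. a i (w i)))\<^sup>2"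
      using insert.hyps by (simp add: add.assoc)
  qed
  also have "\<dots> = (\<Sum>b\<in>S. ?m ^ card I * ((c + a i b)\<^sup>2 + ?V))"
    using insert.prems by (intro sum.cong refl insert.IH) auto
  also have "\<dots> = ?m ^ card I * (\<Sum>b\<in>S. c\<^sup>2 + ?V + 2 * c * a i b + (a i b)\<^sup>2)"
    unfolding sum_distrib_left
    by (intro sum.cong refl) (simp add: power2_sum algebra_simps)
  also have "\<dots> = ?m ^ card I * (?m * (c\<^sup>2 + ?V) + 2 * c * (\<Sum>b\<in>S. a i b) + (\<Sum>b\<in>S. (a i b)\<^sup>2))"
    by (simp add: sum.distrib sum_distrib_left)
  also have "(\<Sum>b\<in>S. a i b) = 0" using insert.prems by simp
  also have "?m ^ card I * (?m * (c\<^sup>2 + ?V) + 2 * c * 0 + (\<Sum>b\<in>S. (a i b)\<^sup>2)) =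
      ?m ^ card (insert i I) * (c\<^sup>2 + (\<Sum>i\<in>insert i I. \<Sum>b\<in>S. (a i b)\<^sup>2) / ?m)"
    using insert.hyps m by (simp add: field_simps)
  finally show ?case .
qed

text \<open>If the right side is below one, then Markov's inequality at \<open>R - v\<close> is at
  least as strong; otherwise there is nothing to prove. The weaker form is affine in
  \<open>v\<close>, so it can be averaged over the message tuples.\<close>

lemma gauss_shifted_energy_tail:
  assumes s: "s > 0" and v: "v \<ge> 0" and R: "R > 0"
  shows "measure (gauss n (\<lambda>_. 0) s)
      {z \<in> space (gauss n (\<lambda>_. 0) s). R - v \<le> (\<Sum>j\<in>{1..n}. (z j)\<^sup>2)} \<le> (real n * s\<^sup>2 + v) / R"
proof -
  interpret prob_space "gauss n (\<lambda>_. 0) s" using s by (rule prob_space_gauss)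
  show ?thesis
  proof (cases "real n * s\<^sup>2 \<le> R - v \<and> v < R")
    case True
    then have "real n * s\<^sup>2 / (R - v) \<le> (real n * s\<^sup>2 + v) / R"
      using v R mult_left_mono[of "real n * s\<^sup>2" "R - v" v]
      by (simp add: divide_le_eq) (simp add: field_simps)
    moreover have "prob {z \<in> space (gauss n (\<lambda>_. 0) s). R - v \<le> (\<Sum>j\<in>{1..n}. (z j)\<^sup>2)}
        \<le> real n * s\<^sup>2 / (R - v)"
      using True by (intro gauss_energy_tail s) auto
    ultimately show ?thesis by linarith
  next
    case False
    then have "R \<le> real n * s\<^sup>2 + v" using zero_le_power2[of s] by (auto simp: not_le add_increasing)
    then have "1 \<le> (real n * s\<^sup>2 + v) / R" using R by simp
    then show ?thesis using prob_le_1 by (rule order_trans[rotated])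
  qed
qed

text \<open>The narrow density is bounded by its peak, whatever its centre. Relative to the wide
  density this costs \<open>sqrt (s\<^sup>2 + P) / s\<close> per coordinate, which yields the
  logarithmic term, and the exponential of the energy around \<open>c0\<close>, which is at most
  \<open>\<rho>\<close> after truncation. The last summand is the probability that the truncation
  fails.\<close>

lemma gauss_wide_center_bound:
  assumes s: "s > 0" and P: "P \<ge> 0" and \<rho>: "\<rho> > 0" and n: "n \<ge> 1" and B: "B \<in> sets (vec_space n)"
  shows "measure (gauss n c s) B \<le>
    exp (real n / 2 * ln (1 + P / s\<^sup>2) + \<rho>) * measure (gauss n c0 (sqrt (s\<^sup>2 + P))) B
    + (real n * s\<^sup>2 + (\<Sum>j\<in>{1..n}. (c j - c0 j)\<^sup>2)) / (\<rho> * (s\<^sup>2 + P))"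
proof -
  let ?s' = "sqrt (s\<^sup>2 + P)"
  have s2: "s\<^sup>2 + P > 0" using s P by (simp add: add_pos_nonneg)
  then have s': "?s' > 0" by simp
  have s'2: "?s'\<^sup>2 = s\<^sup>2 + P" using s2 by simp
  interpret P: prob_space "gauss n c s" using s by (intro prob_space_gauss)
  interpret Q: prob_space "gauss n c0 ?s'" using s' by (intro prob_space_gauss)
  interpret Z: prob_space "gauss n (\<lambda>_. 0) s" using s by (intro prob_space_gauss)
  define v where "v = (\<Sum>j\<in>{1..n}. (c j - c0 j)\<^sup>2)"
  \<comment> \<open>Energy up to \<open>2 * R\<close> contributes
    \<open>2 * R / (2 * (s\<^sup>2 + P)) = \<rho>\<close> to the exponent.\<close>
  define R where "R = \<rho> * (s\<^sup>2 + P)"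
  have R: "R > 0" using \<rho> s2 by (simp add: R_def)
  have v: "v \<ge> 0" by (simp add: v_def sum_nonneg)
  define G where "G = {y \<in> space (vec_space n). (\<Sum>j\<in>{1..n}. (y j - c0 j)\<^sup>2) \<le> 2 * R}"
  have G [measurable]: "G \<in> sets (vec_space n)" unfolding G_def by measurable
  let ?G' = "{y \<in> space (vec_space n). 2 * R < (\<Sum>j\<in>{1..n}. (y j - c0 j)\<^sup>2)}"
  have G': "?G' \<in> sets (vec_space n)" by measurable
  let ?C = "exp (real n / 2 * ln (1 + P / s\<^sup>2) + \<rho>)"
  have "measure (gauss n c s) B \<le> measure (gauss n c s) ((B \<inter> G) \<union> ?G')"
    using B G G' sets.sets_into_space[OF B]
    by (intro P.finite_measure_mono) (auto simp: G_def not_le)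
  also have "\<dots> \<le> measure (gauss n c s) (B \<inter> G) + measure (gauss n c s) ?G'"
    using B G G' by (intro measure_Un_le) auto
  also have "measure (gauss n c s) (B \<inter> G) \<le> ?C * measure (gauss n c0 ?s') (B \<inter> G)"
  proof (intro gauss_change_of_measure s s')
    fix y assume y: "y \<in> B \<inter> G"
    let ?k = "exp (ln (1 + P / s\<^sup>2) / 2)"
    have k: "?k = ?s' / s"
    proof -
      have eq: "1 + P / s\<^sup>2 = (s\<^sup>2 + P) / s\<^sup>2" using s by (simp add: field_simps)
      have "?k = exp (ln (sqrt (1 + P / s\<^sup>2)))"
        using s P by (subst ln_sqrt) (auto simp: add_pos_nonneg)
      also have "\<dots> = sqrt ((s\<^sup>2 + P) / s\<^sup>2)"
        unfolding eq using s s2 by (intro exp_ln real_sqrt_gt_zero divide_pos_pos) auto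
      also have "\<dots> = ?s' / s" using s by (simp add: real_sqrt_divide)
      finally show ?thesis .
    qed
    have coord: "normal_density (c j) s (y j) \<le>
        ?k * exp ((y j - c0 j)\<^sup>2 / (2 * (s\<^sup>2 + P))) * normal_density (c0 j) ?s' (y j)" for j
    proof -
      have "normal_density (c j) s (y j) \<le> 1 / sqrt (2 * pi * s\<^sup>2)"
        unfolding normal_density_def
        using mult_left_mono[of "exp (- (y j - c j)\<^sup>2 / (2 * s\<^sup>2))" 1 "1 / sqrt (2 * pi * s\<^sup>2)"]
        by simp
      also have "\<dots> = ?k * (1 / sqrt (2 * pi * ?s'\<^sup>2))"
        unfolding k real_sqrt_mult real_sqrt_abs using s s' by simp
      also have "\<dots> = ?k * (1 / sqrt (2 * pi * ?s'\<^sup>2)) *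
          (exp ((y j - c0 j)\<^sup>2 / (2 * ?s'\<^sup>2)) * exp (- (y j - c0 j)\<^sup>2 / (2 * ?s'\<^sup>2)))"
        by (simp only: exp_add[symmetric]) simp
      also have "\<dots> = ?k * exp ((y j - c0 j)\<^sup>2 / (2 * ?s'\<^sup>2)) * normal_density (c0 j) ?s' (y j)"
        unfolding normal_density_def by (simp only: mult_ac)
      finally show ?thesis unfolding s'2 .
    qed
    have "(\<Prod>j\<in>{1..n}. normal_density (c j) s (y j)) \<le>
        (\<Prod>j\<in>{1..n}. ?k * exp ((y j - c0 j)\<^sup>2 / (2 * (s\<^sup>2 + P))) * normal_density (c0 j) ?s' (y j))"
      by (intro prod_mono conjI coord normal_density_nonneg)
    also have "\<dots> = exp (real n / 2 * ln (1 + P / s\<^sup>2) + (\<Sum>j\<in>{1..n}. (y j - c0 j)\<^sup>2) / (2 * (s\<^sup>2 + P))) *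
        (\<Prod>j\<in>{1..n}. normal_density (c0 j) ?s' (y j))"
      by (simp add: prod.distrib exp_sum[symmetric] exp_add exp_of_nat_mult[symmetric] sum_divide_distrib)
    also have "\<dots> \<le> ?C * (\<Prod>j\<in>{1..n}. normal_density (c0 j) ?s' (y j))"
    proof (intro mult_right_mono prod_nonneg)
      have "(\<Sum>j\<in>{1..n}. (y j - c0 j)\<^sup>2) / (2 * (s\<^sup>2 + P)) \<le> \<rho>"
        using y s2 by (simp add: G_def R_def divide_le_eq algebra_simps)
      then show "exp (real n / 2 * ln (1 + P / s\<^sup>2) + (\<Sum>j\<in>{1..n}. (y j - c0 j)\<^sup>2) / (2 * (s\<^sup>2 + P))) \<le> ?C"
        by simp
    qed auto
    finally show "(\<Prod>j\<in>{1..n}. normal_density (c j) s (y j)) \<le>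
        ?C * (\<Prod>j\<in>{1..n}. normal_density (c0 j) ?s' (y j))" .
  qed (use B G in auto)
  also have "measure (gauss n c0 ?s') (B \<inter> G) \<le> measure (gauss n c0 ?s') B"
    using B by (intro Q.finite_measure_mono) auto
  also have "measure (gauss n c s) ?G' \<le> (real n * s\<^sup>2 + v) / R"
  proof -
    have "measure (gauss n c s) ?G' =
        measure (gauss n (\<lambda>_. 0) s) {z \<in> space (gauss n (\<lambda>_. 0) s). (\<lambda>j\<in>{1..n}. c j + z j) \<in> ?G'}"
      by (rule measure_gauss_shift[OF s G'])
    also have "\<dots> \<le> measure (gauss n (\<lambda>_. 0) s)
        {z \<in> space (gauss n (\<lambda>_. 0) s). R - v \<le> (\<Sum>j\<in>{1..n}. (z j)\<^sup>2)}"
    proof (intro Z.finite_measure_mono)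
      \<comment> \<open>Since the energy of \<open>z + (c - c0)\<close> is at most twice that of
        \<open>z\<close> plus \<open>2 * v\<close>, an energy above \<open>2 * R\<close> leaves at
        least \<open>R - v\<close> to the noise.\<close>
      have "R - v \<le> (\<Sum>j\<in>{1..n}. (z j)\<^sup>2)"
        if *: "2 * R < (\<Sum>j\<in>{1..n}. ((\<lambda>j\<in>{1..n}. c j + z j) j - c0 j)\<^sup>2)" for z
      proof -
        have "(\<Sum>j\<in>{1..n}. ((\<lambda>j\<in>{1..n}. c j + z j) j - c0 j)\<^sup>2) \<le>
            (\<Sum>j\<in>{1..n}. 2 * (z j)\<^sup>2 + 2 * (c j - c0 j)\<^sup>2)"
        proof (intro sum_mono)
          fix j assume "j \<in> {1..n}"
          then show "((\<lambda>j\<in>{1..n}. c j + z j) j - c0 j)\<^sup>2 \<le> 2 * (z j)\<^sup>2 + 2 * (c j - c0 j)\<^sup>2"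
            using zero_le_power2[of "z j - (c j - c0 j)"] by (simp add: power2_eq_square algebra_simps)
        qed
        also have "\<dots> = 2 * (\<Sum>j\<in>{1..n}. (z j)\<^sup>2) + 2 * v"
          by (simp add: v_def sum.distrib sum_distrib_left)
        finally show ?thesis using * by simp
      qed
      then show "{z \<in> space (gauss n (\<lambda>_. 0) s). (\<lambda>j\<in>{1..n}. c j + z j) \<in> ?G'} \<subseteq>
          {z \<in> space (gauss n (\<lambda>_. 0) s). R - v \<le> (\<Sum>j\<in>{1..n}. (z j)\<^sup>2)}"
        by auto
    qed measurable
    also have "\<dots> \<le> (real n * s\<^sup>2 + v) / R"
      by (rule gauss_shifted_energy_tail[OF s v R])
    finally show ?thesis .
  qed
  finally show ?thesis by (simp add: v_def R_def)
qed

text \<open>All message tuples are tested against one wide law whose extra variance \<open>P\<close>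
  is the total energy per symbol. By independence of the messages, the squared distance of the
  superposition from its mean \<open>c0\<close> is on average at most \<open>K * E = n * P\<close>;
  individual tuples may lie much farther away.\<close>

lemma converse_sum_rate:
  assumes N0: "N0 > 0" and M: "M \<ge> 1" and \<epsilon>: "\<epsilon> < 1" and code: "symmetric_code N0 K n M E \<epsilon> x d"
    and E: "E > 0" and n: "n \<ge> 1"
  shows "real K * ln (real M) \<le>
    real n / 2 * ln (1 + 2 * real K * E / (real n * N0)) + 2 * real n / (1 - \<epsilon>) + ln (2 / (1 - \<epsilon>))"
proof -
  let ?W = "{1..K} \<rightarrow>\<^sub>E {1..M}" and ?s = "sqrt (N0 / 2)"
  let ?B = "\<lambda>w. {y \<in> space (vec_space n). d y = w}"
  define p where "p w = measure (gauss n (superposition x K w) ?s) (?B w)" for w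
  define P where "P = real K * E / real n"
  \<comment> \<open>The truncation probability averages to at most \<open>n / \<rho>\<close>, and
    this choice makes it half of the guaranteed success probability.\<close>
  define \<rho> where "\<rho> = 2 * real n / (1 - \<epsilon>)"
  define m where "m i j = (\<Sum>b\<in>{1..M}. x i b j) / real M" for i j
  define c0 where "c0 j = (\<Sum>i=1..K. m i j)" for j
  define q where "q w = (\<Sum>j\<in>{1..n}. (superposition x K w j - c0 j)\<^sup>2)" for w
  define A where "A = exp (real n / 2 * ln (1 + P / ?s\<^sup>2) + \<rho>)"
  have s: "?s > 0" and s2: "?s\<^sup>2 = N0 / 2" using N0 by auto
  have P: "P \<ge> 0" using E by (simp add: P_def)
  have \<rho>: "\<rho> > 0" using n \<epsilon> by (simp add: \<rho>_def)
  have sP: "?s\<^sup>2 + P > 0" using N0 P by (simp add: s2 add_pos_nonneg)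
  have d: "d \<in> decoders K n M" using code by (simp add: symmetric_code_def)
  have card: "card ?W = M ^ K" by (simp add: card_PiE)
  have finW: "finite ?W" by (intro finite_PiE) auto
  have Mp: "real M > 0" using M by simp
  have zero: "(\<Sum>b\<in>{1..M}. x i b j - m i j) = 0" for i j
    using Mp by (simp add: m_def sum_subtractf)
  have energy: "(\<Sum>w\<in>?W. q w) \<le> real M ^ K * (real K * E)"
  proof -
    have "(\<Sum>w\<in>?W. q w) = (\<Sum>j\<in>{1..n}. \<Sum>w\<in>?W. (0 + (\<Sum>i\<in>{1..K}. x i (w i) j - m i j))\<^sup>2)"
      unfolding q_def c0_def superposition_def sum_subtractf
      by (subst sum.swap) simp
    also have "\<dots> = (\<Sum>j\<in>{1..n}. real M ^ K * ((\<Sum>i\<in>{1..K}. \<Sum>b\<in>{1..M}. (x i b j - m i j)\<^sup>2) / real M))"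
      using M by (intro sum.cong refl, subst sum_PiE_square_zero_mean) (auto simp: zero)
    also have "\<dots> = real M ^ K * ((\<Sum>j\<in>{1..n}. \<Sum>i\<in>{1..K}. \<Sum>b\<in>{1..M}. (x i b j - m i j)\<^sup>2) / real M)"
      by (simp add: sum_distrib_left sum_divide_distrib)
    \<comment> \<open>Centring at the codebook mean can only lower the energy.\<close>
    also have "(\<Sum>j\<in>{1..n}. \<Sum>i\<in>{1..K}. \<Sum>b\<in>{1..M}. (x i b j - m i j)\<^sup>2) \<le>
        (\<Sum>j\<in>{1..n}. \<Sum>i\<in>{1..K}. \<Sum>b\<in>{1..M}. (x i b j)\<^sup>2)"
    proof (rule sum_mono, rule sum_mono)
      fix i j
      have "(\<Sum>b\<in>{1..M}. (x i b j)\<^sup>2) =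
          (\<Sum>b\<in>{1..M}. (x i b j - m i j)\<^sup>2 + 2 * m i j * (x i b j - m i j) + (m i j)\<^sup>2)"
        by (intro sum.cong refl) (simp add: power2_eq_square algebra_simps)
      also have "\<dots> = (\<Sum>b\<in>{1..M}. (x i b j - m i j)\<^sup>2) + real M * (m i j)\<^sup>2"
        by (simp only: sum.distrib sum_distrib_left[symmetric] zero) simp
      finally show "(\<Sum>b\<in>{1..M}. (x i b j - m i j)\<^sup>2) \<le> (\<Sum>b\<in>{1..M}. (x i b j)\<^sup>2)" by simp
    qed
    also have "(\<Sum>j\<in>{1..n}. \<Sum>i\<in>{1..K}. \<Sum>b\<in>{1..M}. (x i b j)\<^sup>2) =
        (\<Sum>i\<in>{1..K}. \<Sum>b\<in>{1..M}. \<Sum>j\<in>{1..n}. (x i b j)\<^sup>2)"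
      by (subst sum.swap) (intro sum.cong refl sum.swap)
    also have "\<dots> \<le> (\<Sum>i\<in>{1..K}. \<Sum>b\<in>{1..M}. E)"
      using code by (intro sum_mono) (auto simp: symmetric_code_def)
    also have "\<dots> = real K * (real M * E)" by simp
    finally show ?thesis using Mp by (simp add: divide_right_mono mult_left_mono)
  qed
  have "(1 - \<epsilon>) * real M ^ K \<le> (\<Sum>w\<in>?W. p w)"
    unfolding p_def by (rule symmetric_code_correct_sum[OF N0 M code])
  also have "\<dots> \<le> (\<Sum>w\<in>?W. A * measure (gauss n c0 (sqrt (?s\<^sup>2 + P))) (?B w) +
      (real n * ?s\<^sup>2 + q w) / (\<rho> * (?s\<^sup>2 + P)))"
    unfolding p_def q_def A_def
    by (intro sum_mono gauss_wide_center_bound s P \<rho> n decoding_region_measurable[OF d])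
  also have "\<dots> = A * (\<Sum>w\<in>?W. measure (gauss n c0 (sqrt (?s\<^sup>2 + P))) (?B w)) +
      (real M ^ K * (real n * ?s\<^sup>2) + (\<Sum>w\<in>?W. q w)) / (\<rho> * (?s\<^sup>2 + P))"
    by (simp add: sum.distrib sum_distrib_left sum_divide_distrib add_divide_distrib card)
  also have "\<dots> \<le> A * 1 + (real M ^ K * (real n * ?s\<^sup>2) + real M ^ K * (real K * E)) / (\<rho> * (?s\<^sup>2 + P))"
  proof (intro add_mono mult_left_mono divide_right_mono energy order_refl)
    show "(\<Sum>w\<in>?W. measure (gauss n c0 (sqrt (?s\<^sup>2 + P))) (?B w)) \<le> 1"
    proof (rule sum_disjoint_measure_le[OF _ finW])
      show "prob_space (gauss n c0 (sqrt (?s\<^sup>2 + P)))"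
        using sP by (intro prob_space_gauss) simp
      show "disjoint_family_on ?B ?W" by (auto simp: disjoint_family_on_def)
    qed (use decoding_region_measurable[OF d] in auto)
  qed (use \<rho> sP in \<open>auto simp: A_def\<close>)
  also have "(real M ^ K * (real n * ?s\<^sup>2) + real M ^ K * (real K * E)) / (\<rho> * (?s\<^sup>2 + P)) =
      real M ^ K * ((1 - \<epsilon>) / 2)"
  proof -
    have "real n * ?s\<^sup>2 + real K * E = real n * (?s\<^sup>2 + P)"
      using n by (simp add: P_def field_simps)
    then have "(real M ^ K * (real n * ?s\<^sup>2) + real M ^ K * (real K * E)) / (\<rho> * (?s\<^sup>2 + P)) =
        real M ^ K * (real n * (?s\<^sup>2 + P)) / (\<rho> * (?s\<^sup>2 + P))"
      by (simp only: distrib_left[symmetric])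
    also have "\<dots> = real M ^ K * (real n / \<rho>)" using sP by simp
    also have "real n / \<rho> = (1 - \<epsilon>) / 2" using n \<epsilon> by (simp add: \<rho>_def field_simps)
    finally show ?thesis .
  qed
  finally have "real M ^ K \<le> A * (2 / (1 - \<epsilon>))"
    using \<epsilon> by (simp add: field_simps)
  then have "ln (real M ^ K) \<le> ln (A * (2 / (1 - \<epsilon>)))"
    using Mp by (intro ln_mono) auto
  also have "\<dots> = ln A + ln (2 / (1 - \<epsilon>))"
    using \<epsilon> by (intro ln_mult_pos) (auto simp: A_def)
  finally show ?thesis
    using Mp N0 n by (simp add: A_def ln_realpow \<rho>_def P_def s2 field_simps)
qed

section \<open>Random antipodal codes\<close>

lemma cosh_le_exp_square:
  fixes t :: real
  assumes "0 \<le> t" "t \<le> 1"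
  shows "cosh t \<le> exp (t\<^sup>2)"
proof -
  have "exp t \<le> 1 + t + t\<^sup>2" using assms by (rule exp_bound)
  moreover have "exp (- t) \<le> 1 - t + t\<^sup>2"
  proof -
    \<comment> \<open>The product is \<open>1 + t ^ 3\<close>.\<close>
    have "1 \<le> (1 - t + t\<^sup>2) * (1 + t)" using assms by (simp add: algebra_simps power2_eq_square)
    also have "\<dots> \<le> (1 - t + t\<^sup>2) * exp t"
      using assms by (intro mult_left_mono exp_ge_add_one_self) auto
    finally show ?thesis by (simp add: exp_minus field_simps)
  qed
  ultimately have "cosh t \<le> 1 + t\<^sup>2" by (simp add: cosh_field_def)
  also have "\<dots> \<le> exp (t\<^sup>2)" by (rule exp_ge_add_one_self)
  finally show ?thesis .
qed

lemma exists_le_average: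
  fixes f :: "'a \<Rightarrow> real"
  assumes "finite A" "A \<noteq> {}" "(\<Sum>v\<in>A. f v) \<le> real (card A) * c"
  shows "\<exists>v\<in>A. f v \<le> c"
proof (rule ccontr)
  assume "\<not> ?thesis"
  then have "(\<Sum>v\<in>A. c) < (\<Sum>v\<in>A. f v)" using assms by (intro sum_strict_mono) auto
  then show False using assms(3) by simp
qed

text \<open>For uniformly random signs \<open>v\<close> and fixed \<open>w\<close>, the products
  \<open>v l * s w l\<close> are independent fair signs, so each exponential has mean
  \<open>cosh t ^ L\<close>. Some \<open>v\<close> does no worse than the average.\<close>

lemma exists_sign_vector:
  fixes s :: "nat \<Rightarrow> nat \<Rightarrow> real"
  assumes s: "\<And>w l. l \<in> {1..L} \<Longrightarrow> s w l \<in> {-1, 1}"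
  shows "\<exists>v\<in>{1..L} \<rightarrow>\<^sub>E {-1, 1}. (\<Sum>w\<in>{1..M}. exp (t * (\<Sum>l\<in>{1..L}. v l * s w l))) \<le> real M * cosh t ^ L"
proof (rule exists_le_average)
  let ?V = "{1..L} \<rightarrow>\<^sub>E {-1, 1 :: real}"
  show "finite ?V" by (intro finite_PiE) auto
  show "?V \<noteq> {}" by (auto simp: PiE_eq_empty_iff)
  have "(\<Sum>v\<in>?V. \<Sum>w\<in>{1..M}. exp (t * (\<Sum>l\<in>{1..L}. v l * s w l))) =
      (\<Sum>w\<in>{1..M}. \<Sum>v\<in>?V. \<Prod>l\<in>{1..L}. exp (t * (v l * s w l)))"
    by (subst sum.swap) (simp add: exp_sum sum_distrib_left)
  also have "\<dots> = (\<Sum>w\<in>{1..M}. \<Prod>l\<in>{1..L}. \<Sum>b\<in>{-1, 1}. exp (t * (b * s w l)))"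
    by (intro sum.cong refl prod_sum_PiE[symmetric]) auto
  also have "\<dots> = (\<Sum>w\<in>{1..M}. \<Prod>l\<in>{1..L}. 2 * cosh t)"
  proof (intro sum.cong prod.cong refl)
    fix w l assume "l \<in> {1..L}"
    then show "(\<Sum>b\<in>{-1, 1}. exp (t * (b * s w l))) = 2 * cosh t"
      using s[of l w] by (auto simp: cosh_field_def)
  qed
  also have "\<dots> = real (card ?V) * (real M * cosh t ^ L)"
    by (simp add: card_PiE power_mult_distrib)
  finally show "(\<Sum>v\<in>?V. \<Sum>w\<in>{1..M}. exp (t * (\<Sum>l\<in>{1..L}. v l * s w l))) \<le>
      real (card ?V) * (real M * cosh t ^ L)" by simp
qed

text \<open>The random coding argument made greedy: codewords are added one at a time. Each new one
  enters as sent word and as competitor, which adds at most \<open>2 * M * cosh t ^ L\<close>, and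
  \<open>M\<^sup>2 + 2 * M \<le> (M + 1)\<^sup>2\<close>.\<close>

lemma exists_sign_codebook:
  "\<exists>s :: nat \<Rightarrow> nat \<Rightarrow> real. (\<forall>w. \<forall>l\<in>{1..L}. s w l \<in> {-1, 1}) \<and>
    (\<Sum>w\<in>{1..M}. \<Sum>m\<in>{1..M} - {w}. exp (t * (\<Sum>l\<in>{1..L}. s m l * s w l))) \<le> (real M)\<^sup>2 * cosh t ^ L"
proof (induction M)
  case 0
  show ?case by (intro exI[of _ "\<lambda>_ _. 1"]) auto
next
  case (Suc M)
  then obtain s :: "nat \<Rightarrow> nat \<Rightarrow> real" where s: "\<And>w l. l \<in> {1..L} \<Longrightarrow> s w l \<in> {-1, 1}"
    and le: "(\<Sum>w\<in>{1..M}. \<Sum>m\<in>{1..M} - {w}. exp (t * (\<Sum>l\<in>{1..L}. s m l * s w l))) \<le> (real M)\<^sup>2 * cosh t ^ L"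
    by blast
  obtain v where v: "v \<in> {1..L} \<rightarrow>\<^sub>E {-1, 1}"
    and vle: "(\<Sum>w\<in>{1..M}. exp (t * (\<Sum>l\<in>{1..L}. v l * s w l))) \<le> real M * cosh t ^ L"
    using exists_sign_vector[of L s t M] s by blast
  define s' where "s' = s(Suc M := v)"
  define e where "e m w = exp (t * (\<Sum>l\<in>{1..L}. s' m l * s' w l))" for m w
  have e_sym: "e m w = e w m" for m w by (simp add: e_def mult.commute)
  have old: "e m w = exp (t * (\<Sum>l\<in>{1..L}. s m l * s w l))" if "m \<in> {1..M}" "w \<in> {1..M}" for m w
    using that by (auto simp: e_def s'_def)
  have new: "(\<Sum>w\<in>{1..M}. e (Suc M) w) = (\<Sum>w\<in>{1..M}. exp (t * (\<Sum>l\<in>{1..L}. v l * s w l)))"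
    by (intro sum.cong) (auto simp: e_def s'_def)
  have row: "(\<Sum>m\<in>{1..Suc M} - {w}. e m w) = e (Suc M) w + (\<Sum>m\<in>{1..M} - {w}. e m w)" if "w \<in> {1..M}" for w
  proof -
    have "{1..Suc M} - {w} = insert (Suc M) ({1..M} - {w})" using that by auto
    then show ?thesis by simp
  qed
  have last: "(\<Sum>m\<in>{1..Suc M} - {Suc M}. e m (Suc M)) = (\<Sum>m\<in>{1..M}. e (Suc M) m)"
    by (intro sum.cong e_sym) auto
  have "(\<Sum>w\<in>{1..Suc M}. \<Sum>m\<in>{1..Suc M} - {w}. e m w) =
      (\<Sum>w\<in>{1..M}. \<Sum>m\<in>{1..Suc M} - {w}. e m w) + (\<Sum>m\<in>{1..Suc M} - {Suc M}. e m (Suc M))"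
    by simp
  also have "\<dots> = (\<Sum>w\<in>{1..M}. \<Sum>m\<in>{1..M} - {w}. e m w) + 2 * (\<Sum>w\<in>{1..M}. e (Suc M) w)"
    unfolding last by (simp add: row sum.distrib)
  also have "(\<Sum>w\<in>{1..M}. \<Sum>m\<in>{1..M} - {w}. e m w) =
      (\<Sum>w\<in>{1..M}. \<Sum>m\<in>{1..M} - {w}. exp (t * (\<Sum>l\<in>{1..L}. s m l * s w l)))"
    by (intro sum.cong refl old) auto
  also have "\<dots> + 2 * (\<Sum>w\<in>{1..M}. e (Suc M) w) \<le> (real M)\<^sup>2 * cosh t ^ L + 2 * (real M * cosh t ^ L)"
    using le vle unfolding new by linarith
  also have "\<dots> \<le> (real (Suc M))\<^sup>2 * cosh t ^ L"
    by (simp add: power2_eq_square algebra_simps)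
  finally have "(\<Sum>w\<in>{1..Suc M}. \<Sum>m\<in>{1..Suc M} - {w}. e m w) \<le> (real (Suc M))\<^sup>2 * cosh t ^ L" .
  moreover have "\<forall>w. \<forall>l\<in>{1..L}. s' w l \<in> {-1, 1}"
    using s v by (auto simp: s'_def)
  ultimately show ?case unfolding e_def by blast
qed

text \<open>Each coordinate of a uniform tuple is itself uniform. The summand is written as a
  product with factor \<open>1\<close> at all other coordinates, so that the sum factorises.\<close>

lemma sum_PiE_coordinate:
  fixes g :: "'b \<Rightarrow> real"
  assumes I: "finite I" "i \<in> I" and S: "finite S" "S \<noteq> {}"
  shows "(\<Sum>w\<in>I \<rightarrow>\<^sub>E S. g (w i)) = real (card S) ^ card I * ((\<Sum>b\<in>S. g b) / real (card S))"
proof -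
  let ?f = "\<lambda>i' b. if i' = i then g b else 1"
  have "(\<Sum>w\<in>I \<rightarrow>\<^sub>E S. g (w i)) = (\<Sum>w\<in>I \<rightarrow>\<^sub>E S. \<Prod>i'\<in>I. ?f i' (w i'))"
    using I by (intro sum.cong refl) (simp add: prod.remove[of I i])
  also have "\<dots> = (\<Prod>i'\<in>I. \<Sum>b\<in>S. ?f i' b)"
    using I S by (intro prod_sum_PiE[symmetric]) auto
  also have "\<dots> = (\<Sum>b\<in>S. g b) * (\<Prod>i'\<in>I - {i}. real (card S))"
    using I by (simp add: prod.remove[of I i])
  also have "\<dots> = real (card S) ^ card I * ((\<Sum>b\<in>S. g b) / real (card S))"
  proof -
    obtain c where "card I = Suc c" using I by (metis card_gt_0_iff empty_iff gr0_implies_Suc)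
    moreover have "real (card S) > 0" using S by (simp add: card_gt_0_iff)
    ultimately show ?thesis using I by (simp add: card_Diff_singleton)
  qed
  finally show ?thesis .
qed

section \<open>Disjoint blocks and threshold decoding\<close>

definition block_codeword :: "nat \<Rightarrow> real \<Rightarrow> (nat \<Rightarrow> nat \<Rightarrow> real) \<Rightarrow> nat \<Rightarrow> nat \<Rightarrow> nat \<Rightarrow> real" where
  "block_codeword L a s i w j =
     (if j \<in> {(i - 1) * L + 1..(i - 1) * L + L} then a * s w (j - (i - 1) * L) else 0)"

lemma sum_block:
  fixes f :: "nat \<Rightarrow> real"
  assumes i: "i \<in> {1..K}" and n: "K * L \<le> n"
    and zero: "\<And>j. j \<notin> {(i - 1) * L + 1..(i - 1) * L + L} \<Longrightarrow> f j = 0"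
  shows "(\<Sum>j\<in>{1..n}. f j) = (\<Sum>l\<in>{1..L}. f ((i - 1) * L + l))"
proof -
  have "(i - 1) * L + L = i * L" using i by (cases i) auto
  also have "\<dots> \<le> K * L" using i by simp
  also note n
  finally have le: "(i - 1) * L + L \<le> n" .
  have "(\<Sum>j\<in>{1..n}. f j) = (\<Sum>j\<in>{(i - 1) * L + 1..(i - 1) * L + L}. f j)"
    using le zero by (intro sum.mono_neutral_right) auto
  also have "\<dots> = (\<Sum>l\<in>{1..L}. f ((i - 1) * L + l))"
    by (rule sum.reindex_bij_witness[of _ "\<lambda>l. (i - 1) * L + l" "\<lambda>j. j - (i - 1) * L"]) auto
  finally show ?thesis .
qed

lemma block_codeword_inner:
  assumes "i \<in> {1..K}" "K * L \<le> n"
  shows "(\<Sum>j\<in>{1..n}. block_codeword L a s i m j * block_codeword L a s i w j) =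
    a\<^sup>2 * (\<Sum>l\<in>{1..L}. s m l * s w l)"
  by (subst sum_block[OF assms])
     (auto simp: block_codeword_def sum_distrib_left power2_eq_square intro!: sum.cong)

text \<open>The blocks of other users do not meet block \<open>i\<close>, so a correlation with a
  codeword of user \<open>i\<close> sees no interference.\<close>

lemma block_codeword_superposition:
  assumes i: "i \<in> {1..K}" and n: "K * L \<le> n"
  shows "(\<Sum>j\<in>{1..n}. block_codeword L a s i m j * superposition (block_codeword L a s) K w j) =
    a\<^sup>2 * (\<Sum>l\<in>{1..L}. s m l * s (w i) l)"
proof -
  let ?x = "block_codeword L a s"
  have "?x i m j * superposition ?x K w j = ?x i m j * ?x i (w i) j" for j
  proof (cases "j \<in> {(i - 1) * L + 1..(i - 1) * L + L}")
    case True
    have "?x i' (w i') j = 0" if i': "i' \<in> {1..K} - {i}" for i'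
    proof -
      consider "i' + 1 \<le> i" | "i + 1 \<le> i'" using i' by force
      then have "j \<notin> {(i' - 1) * L + 1..(i' - 1) * L + L}"
      proof cases
        case 1
        then have "(i' - 1) + 1 \<le> i - 1" using i' by auto
        then have "(i' - 1) * L + L \<le> (i - 1) * L"
          using mult_le_mono1[of "(i' - 1) + 1" "i - 1" L] by (simp add: algebra_simps)
        then show ?thesis using True by auto
      next
        case 2
        then have "(i - 1) + 1 \<le> i' - 1" using i by auto
        then have "(i - 1) * L + L \<le> (i' - 1) * L"
          using mult_le_mono1[of "(i - 1) + 1" "i' - 1" L] by (simp add: algebra_simps)
        then show ?thesis using True by auto
      qed
      then show ?thesis by (auto simp: block_codeword_def)
    qed
    then have "superposition ?x K w j = ?x i (w i) j"
      unfolding superposition_def using i by (subst sum.remove[of _ i]) auto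
    then show ?thesis by simp
  next
    case False
    then show ?thesis by (auto simp: block_codeword_def)
  qed
  then show ?thesis by (simp only: block_codeword_inner[OF i n])
qed

text \<open>The disjunct \<open>M \<le> m\<close> makes \<open>LEAST\<close> well defined when no codeword reaches the threshold.\<close>

definition threshold_decoder ::
  "nat \<Rightarrow> nat \<Rightarrow> nat \<Rightarrow> (nat \<Rightarrow> nat \<Rightarrow> nat \<Rightarrow> real) \<Rightarrow> real \<Rightarrow> (nat \<Rightarrow> real) \<Rightarrow> (nat \<Rightarrow> nat)" where
  "threshold_decoder K n M x \<theta> y =
     (\<lambda>i\<in>{1..K}. LEAST m. 1 \<le> m \<and> (\<theta> \<le> (\<Sum>j\<in>{1..n}. x i m j * y j) \<or> M \<le> m))"

lemma threshold_decoder_in: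
  assumes M: "M \<ge> 1"
  shows "threshold_decoder K n M x \<theta> y \<in> {1..K} \<rightarrow>\<^sub>E {1..M}"
proof -
  let ?Q = "\<lambda>i m. 1 \<le> m \<and> (\<theta> \<le> (\<Sum>j\<in>{1..n}. x i m j * y j) \<or> M \<le> m)"
  have "?Q i M" for i using M by simp
  then have "1 \<le> (LEAST m. ?Q i m) \<and> (LEAST m. ?Q i m) \<le> M" for i
    using LeastI[of "?Q i" M] Least_le[of "?Q i" M] by blast
  then show ?thesis by (auto simp: threshold_decoder_def)
qed

lemma threshold_decoder_decoders:
  assumes M: "M \<ge> 1"
  shows "threshold_decoder K n M x \<theta> \<in> decoders K n M"
  unfolding decoders_def
proof (subst measurable_count_space_eq2)
  let ?W = "{1..K} \<rightarrow>\<^sub>E {1..M}"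
  let ?g = "\<lambda>i y. LEAST m. 1 \<le> m \<and> (\<theta> \<le> (\<Sum>j\<in>{1..n}. x i m j * y j) \<or> M \<le> m)"
  show "finite ?W" by (intro finite_PiE) auto
  have g: "{y \<in> space (vec_space n). ?g i y = m} \<in> sets (vec_space n)" for i m
  proof -
    have "?g i \<in> measurable (vec_space n) (count_space UNIV)" by measurable
    from measurable_sets[OF this, of "{m}"] show ?thesis
      by (simp add: vimage_def Int_def conj_commute)
  qed
  have "threshold_decoder K n M x \<theta> -` {w} \<inter> space (vec_space n) \<in> sets (vec_space n)" if w: "w \<in> ?W" for w
  proof -
    have "threshold_decoder K n M x \<theta> -` {w} \<inter> space (vec_space n) =
        {y \<in> space (vec_space n). \<forall>i\<in>{1..K}. ?g i y = w i}"
      using w by (auto simp: threshold_decoder_def fun_eq_iff PiE_iff extensional_def)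
    also have "\<dots> \<in> sets (vec_space n)"
      by (intro sets.sets_Collect_finite_All g) auto
    finally show ?thesis .
  qed
  then show "threshold_decoder K n M x \<theta> \<in> space (vec_space n) \<rightarrow> ?W \<and>
      (\<forall>w\<in>?W. threshold_decoder K n M x \<theta> -` {w} \<inter> space (vec_space n) \<in> sets (vec_space n))"
    using threshold_decoder_in[OF M] by auto
qed

text \<open>If the true codeword reaches the threshold and no competitor does, the least qualifying
  index is the true message. The default \<open>M\<close> cannot intervene, because it is never
  smaller than \<open>w i\<close>.\<close>

lemma threshold_decoder_error:
  assumes w: "w \<in> {1..K} \<rightarrow>\<^sub>E {1..M}" and err: "threshold_decoder K n M x \<theta> y \<noteq> w"
  shows "\<exists>i\<in>{1..K}. (\<Sum>j\<in>{1..n}. x i (w i) j * y j) < \<theta> \<or>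
    (\<exists>m\<in>{1..M} - {w i}. \<theta> \<le> (\<Sum>j\<in>{1..n}. x i m j * y j))"
proof (rule ccontr)
  assume "\<not> ?thesis"
  then have ok: "\<theta> \<le> (\<Sum>j\<in>{1..n}. x i (w i) j * y j)"
    and no: "\<And>m. m \<in> {1..M} - {w i} \<Longrightarrow> (\<Sum>j\<in>{1..n}. x i m j * y j) < \<theta>" if "i \<in> {1..K}" for i
    using that by (auto simp: not_less not_le)
  have "(LEAST m. 1 \<le> m \<and> (\<theta> \<le> (\<Sum>j\<in>{1..n}. x i m j * y j) \<or> M \<le> m)) = w i" if i: "i \<in> {1..K}" for i
  proof (rule Least_equality)
    have wi: "1 \<le> w i \<and> w i \<le> M" using PiE_mem[OF w i] by simp
    then show "1 \<le> w i \<and> (\<theta> \<le> (\<Sum>j\<in>{1..n}. x i (w i) j * y j) \<or> M \<le> w i)"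
      using ok[OF i] by simp
    fix m assume m: "1 \<le> m \<and> (\<theta> \<le> (\<Sum>j\<in>{1..n}. x i m j * y j) \<or> M \<le> m)"
    show "w i \<le> m"
    proof (rule ccontr)
      assume "\<not> w i \<le> m"
      then have "m \<in> {1..M} - {w i}" "\<not> M \<le> m" using m wi by auto
      then show False using no[OF i] m by fastforce
    qed
  qed
  then have "threshold_decoder K n M x \<theta> y = w"
    using w by (auto simp: threshold_decoder_def fun_eq_iff PiE_iff extensional_def)
  then show False using err by simp
qed

text \<open>Missing the true codeword at threshold \<open>(1 - \<delta>) * E\<close> gives the first
  exponential. A competitor with sign correlation \<open>\<rho>\<close> passes with probability at
  most \<open>exp (- (1 - 2 * \<delta>) * E / N0) * exp (t * \<rho>)\<close>. Averaging the last
  factor over pairs of the sign codebook costs at most another \<open>\<delta> * E / N0\<close>. A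
  union bound over competitors and users finishes; all users share one sign codebook.\<close>

lemma exists_block_code:
  assumes N0: "N0 > 0" and E: "E > 0" and M: "M \<ge> 1" and L: "L \<ge> 1" and KL: "K * L \<le> n"
    and \<delta>: "0 < \<delta>" "\<delta> \<le> 1" and EL: "4 * E / (N0 * real L) \<le> \<delta>"
  shows "\<exists>x d. symmetric_code N0 K n M E
    (real K * (exp (- \<delta>\<^sup>2 * E / N0) + real M * exp (- (1 - 3 * \<delta>) * E / N0))) x d"
proof -
  \<comment> \<open>Tilting by \<open>2 / N0\<close> multiplies the inner product
    \<open>a\<^sup>2 * \<rho>\<close> of two codewords; with \<open>a\<^sup>2 = E / L\<close> this
    is \<open>t * \<rho>\<close>.\<close>
  define t where "t = 2 * E / (N0 * real L)"
  define a where "a = sqrt (E / real L)"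
  define \<theta> where "\<theta> = (1 - \<delta>) * E"
  define \<sigma> where "\<sigma> = sqrt (N0 / 2)"
  let ?e1 = "exp (- \<delta>\<^sup>2 * E / N0)" and ?e2 = "exp (- (1 - 2 * \<delta>) * E / N0)"
  have \<sigma>: "\<sigma> > 0" and \<sigma>2: "\<sigma>\<^sup>2 = N0 / 2" using N0 by (auto simp: \<sigma>_def)
  have Lp: "real L > 0" using L by simp
  have a2: "a\<^sup>2 = E / real L" using E Lp by (simp add: a_def)
  have t: "0 \<le> t" "t \<le> 1" and t2: "real L * t\<^sup>2 \<le> \<delta> * E / N0"
  proof -
    show "0 \<le> t" using E N0 by (simp add: t_def)
    have "2 * t \<le> 1" using EL \<delta> by (simp add: t_def)
    then show "t \<le> 1" using \<open>0 \<le> t\<close> by linarith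
    have "real L * t\<^sup>2 = (4 * E / (N0 * real L)) * (E / N0)"
      using Lp N0 by (simp add: t_def power2_eq_square field_simps)
    also have "\<dots> \<le> \<delta> * (E / N0)" using EL E N0 by (intro mult_right_mono) auto
    finally show "real L * t\<^sup>2 \<le> \<delta> * E / N0" by simp
  qed
  obtain s :: "nat \<Rightarrow> nat \<Rightarrow> real" where s: "\<And>w l. l \<in> {1..L} \<Longrightarrow> s w l \<in> {-1, 1}"
    and s_le: "(\<Sum>w\<in>{1..M}. \<Sum>m\<in>{1..M} - {w}. exp (t * (\<Sum>l\<in>{1..L}. s m l * s w l))) \<le> (real M)\<^sup>2 * cosh t ^ L"
    using exists_sign_codebook[where L = L and M = M and t = t] by blast
  define x where "x = block_codeword L a s"
  define d where "d = threshold_decoder K n M x \<theta>"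
  define \<rho> where "\<rho> m w = (\<Sum>l\<in>{1..L}. s m l * s w l)" for m w
  let ?W = "{1..K} \<rightarrow>\<^sub>E {1..M}"
  have dec: "d \<in> decoders K n M" unfolding d_def by (rule threshold_decoder_decoders[OF M])
  have \<rho>_same: "\<rho> w w = real L" for w
  proof -
    have "s w l * s w l = 1" if "l \<in> {1..L}" for l using s[OF that, of w] by auto
    then show ?thesis by (simp add: \<rho>_def)
  qed
  have energy: "(\<Sum>j\<in>{1..n}. (x i w j)\<^sup>2) = E" if "i \<in> {1..K}" for i w
    using block_codeword_inner[OF that KL, of a s w w] \<rho>_same[of w] Lp
    by (simp add: x_def \<rho>_def power2_eq_square[of "block_codeword L a s i w _"] a2)
  have corr: "(\<Sum>j\<in>{1..n}. x i m j * superposition x K w j) = a\<^sup>2 * \<rho> m (w i)" if "i \<in> {1..K}" for i m w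
    unfolding x_def \<rho>_def by (rule block_codeword_superposition[OF that KL])

  have err: "measure (gauss n (superposition x K w) \<sigma>) {y \<in> space (vec_space n). d y \<noteq> w} \<le>
      (\<Sum>i\<in>{1..K}. ?e1 + (\<Sum>m\<in>{1..M} - {w i}. ?e2 * exp (t * \<rho> m (w i))))" if w: "w \<in> ?W" for w
  proof -
    interpret P: prob_space "gauss n (superposition x K w) \<sigma>" using \<sigma> by (rule prob_space_gauss)
    interpret Z: prob_space "gauss n (\<lambda>_. 0) \<sigma>" using \<sigma> by (rule prob_space_gauss)
    let ?P = "gauss n (superposition x K w) \<sigma>" and ?Z = "gauss n (\<lambda>_. 0) \<sigma>"
    let ?A = "\<lambda>i. {y \<in> space (vec_space n). (\<Sum>j\<in>{1..n}. x i (w i) j * y j) < \<theta>}"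
    let ?B = "\<lambda>i m. {y \<in> space (vec_space n). \<theta> \<le> (\<Sum>j\<in>{1..n}. x i m j * y j)}"
    have A [measurable]: "?A i \<in> sets (vec_space n)" for i by measurable
    have B [measurable]: "?B i m \<in> sets (vec_space n)" for i m by measurable
    have shifted: "(\<Sum>j\<in>{1..n}. x i m j * (\<lambda>j\<in>{1..n}. superposition x K w j + z j) j) =
        a\<^sup>2 * \<rho> m (w i) + (\<Sum>j\<in>{1..n}. x i m j * z j)" if "i \<in> {1..K}" for i m z
      by (simp add: corr[OF that, symmetric] distrib_left sum.distrib)
    have boundA: "measure ?P (?A i) \<le> ?e1" if i: "i \<in> {1..K}" for i
    proof -
      \<comment> \<open>The optimal tilt for a deviation \<open>\<delta> * E\<close> of a Gaussian
        with variance \<open>N0 * E / 2\<close>.\<close>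
      let ?c = "\<lambda>j. - (2 * \<delta> / N0) * x i (w i) j"
      have "measure ?P (?A i) = measure ?Z {z \<in> space ?Z. (\<lambda>j\<in>{1..n}. superposition x K w j + z j) \<in> ?A i}"
        by (rule measure_gauss_shift[OF \<sigma> A])
      also have "\<dots> \<le> measure ?Z {z \<in> space ?Z. 2 * \<delta>\<^sup>2 * E / N0 \<le> (\<Sum>j\<in>{1..n}. ?c j * z j)}"
      proof (intro Z.finite_measure_mono subsetI)
        fix z assume z: "z \<in> {z \<in> space ?Z. (\<lambda>j\<in>{1..n}. superposition x K w j + z j) \<in> ?A i}"
        then have "E + (\<Sum>j\<in>{1..n}. x i (w i) j * z j) < (1 - \<delta>) * E"
          using shifted[OF i, of "w i" z] Lp by (simp add: a2 \<rho>_same \<theta>_def)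
        then have "\<delta> * E \<le> - (\<Sum>j\<in>{1..n}. x i (w i) j * z j)" by (simp add: algebra_simps)
        then have "(2 * \<delta> / N0) * (\<delta> * E) \<le> (2 * \<delta> / N0) * - (\<Sum>j\<in>{1..n}. x i (w i) j * z j)"
          using \<delta> N0 by (intro mult_left_mono) auto
        also have "\<dots> = (\<Sum>j\<in>{1..n}. ?c j * z j)"
          by (simp add: sum_distrib_left sum_negf mult.assoc)
        finally show "z \<in> {z \<in> space ?Z. 2 * \<delta>\<^sup>2 * E / N0 \<le> (\<Sum>j\<in>{1..n}. ?c j * z j)}"
          using z by (simp add: power2_eq_square)
      qed measurable
      also have "\<dots> \<le> exp (\<sigma>\<^sup>2 * (\<Sum>j\<in>{1..n}. (?c j)\<^sup>2) / 2 - 2 * \<delta>\<^sup>2 * E / N0)"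
        by (rule gauss_chernoff[OF \<sigma>])
      also have "(\<Sum>j\<in>{1..n}. (?c j)\<^sup>2) = (2 * \<delta> / N0)\<^sup>2 * E"
        unfolding energy[OF i, of "w i", symmetric] sum_distrib_left
        by (simp add: power_mult_distrib power_divide)
      also have "\<sigma>\<^sup>2 * ((2 * \<delta> / N0)\<^sup>2 * E) / 2 - 2 * \<delta>\<^sup>2 * E / N0 = - \<delta>\<^sup>2 * E / N0"
        unfolding \<sigma>2 using N0 by (simp add: field_simps power2_eq_square)
      finally show ?thesis .
    qed
    have boundB: "measure ?P (?B i m) \<le> ?e2 * exp (t * \<rho> m (w i))" if i: "i \<in> {1..K}" for i m
    proof -
      \<comment> \<open>The same tilt for every competitor keeps the exponent linear in the
        correlation, as the exponential moments of the sign codebook require.\<close>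
      let ?c = "\<lambda>j. (2 / N0) * x i m j" and ?\<theta> = "(2 / N0) * (\<theta> - a\<^sup>2 * \<rho> m (w i))"
      have "measure ?P (?B i m) = measure ?Z {z \<in> space ?Z. (\<lambda>j\<in>{1..n}. superposition x K w j + z j) \<in> ?B i m}"
        by (rule measure_gauss_shift[OF \<sigma> B])
      also have "\<dots> \<le> measure ?Z {z \<in> space ?Z. ?\<theta> \<le> (\<Sum>j\<in>{1..n}. ?c j * z j)}"
      proof (intro Z.finite_measure_mono subsetI)
        fix z assume z: "z \<in> {z \<in> space ?Z. (\<lambda>j\<in>{1..n}. superposition x K w j + z j) \<in> ?B i m}"
        then have "\<theta> - a\<^sup>2 * \<rho> m (w i) \<le> (\<Sum>j\<in>{1..n}. x i m j * z j)"
          using shifted[OF i, of m z] by simp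
        then have "?\<theta> \<le> (2 / N0) * (\<Sum>j\<in>{1..n}. x i m j * z j)"
          using N0 by (intro mult_left_mono) auto
        also have "\<dots> = (\<Sum>j\<in>{1..n}. ?c j * z j)"
          by (simp add: sum_distrib_left mult.assoc)
        finally show "z \<in> {z \<in> space ?Z. ?\<theta> \<le> (\<Sum>j\<in>{1..n}. ?c j * z j)}"
          using z by simp
      qed measurable
      also have "\<dots> \<le> exp (\<sigma>\<^sup>2 * (\<Sum>j\<in>{1..n}. (?c j)\<^sup>2) / 2 - ?\<theta>)"
        by (rule gauss_chernoff[OF \<sigma>])
      also have "(\<Sum>j\<in>{1..n}. (?c j)\<^sup>2) = (2 / N0)\<^sup>2 * E"
        unfolding energy[OF i, of m, symmetric] sum_distrib_left
        by (simp add: power_mult_distrib power_divide)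
      also have "\<sigma>\<^sup>2 * ((2 / N0)\<^sup>2 * E) / 2 - ?\<theta> = - (1 - 2 * \<delta>) * E / N0 + t * \<rho> m (w i)"
        unfolding \<sigma>2 a2 \<theta>_def t_def using N0 Lp by (simp add: field_simps power2_eq_square)
      finally show ?thesis by (simp only: exp_add)
    qed
    have "{y \<in> space (vec_space n). d y \<noteq> w} \<subseteq> (\<Union>i\<in>{1..K}. ?A i \<union> (\<Union>m\<in>{1..M} - {w i}. ?B i m))"
    proof
      fix y assume "y \<in> {y \<in> space (vec_space n). d y \<noteq> w}"
      then show "y \<in> (\<Union>i\<in>{1..K}. ?A i \<union> (\<Union>m\<in>{1..M} - {w i}. ?B i m))"
        using threshold_decoder_error[OF w, of n x \<theta> y] unfolding d_def by blast
    qed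
    then have "measure ?P {y \<in> space (vec_space n). d y \<noteq> w} \<le>
        measure ?P (\<Union>i\<in>{1..K}. ?A i \<union> (\<Union>m\<in>{1..M} - {w i}. ?B i m))"
      by (intro P.finite_measure_mono) (auto intro!: sets.finite_UN sets.Un A B)
    also have "\<dots> \<le> (\<Sum>i\<in>{1..K}. measure ?P (?A i \<union> (\<Union>m\<in>{1..M} - {w i}. ?B i m)))"
      by (intro P.finite_measure_subadditive_finite) (auto intro!: sets.finite_UN sets.Un A B)
    also have "\<dots> \<le> (\<Sum>i\<in>{1..K}. ?e1 + (\<Sum>m\<in>{1..M} - {w i}. ?e2 * exp (t * \<rho> m (w i))))"
    proof (intro sum_mono)
      fix i assume i: "i \<in> {1..K}"
      have "measure ?P (?A i \<union> (\<Union>m\<in>{1..M} - {w i}. ?B i m)) \<le>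
          measure ?P (?A i) + measure ?P (\<Union>m\<in>{1..M} - {w i}. ?B i m)"
        by (intro measure_Un_le) (auto intro!: sets.finite_UN A B)
      also have "measure ?P (\<Union>m\<in>{1..M} - {w i}. ?B i m) \<le> (\<Sum>m\<in>{1..M} - {w i}. measure ?P (?B i m))"
        by (intro P.finite_measure_subadditive_finite) (auto intro!: B)
      also have "\<dots> \<le> (\<Sum>m\<in>{1..M} - {w i}. ?e2 * exp (t * \<rho> m (w i)))"
        by (intro sum_mono boundB i)
      finally show "measure ?P (?A i \<union> (\<Union>m\<in>{1..M} - {w i}. ?B i m)) \<le>
          ?e1 + (\<Sum>m\<in>{1..M} - {w i}. ?e2 * exp (t * \<rho> m (w i)))"
        using boundA[OF i] by linarith
    qed
    finally show ?thesis .
  qed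

  have Mp: "real M > 0" using M by simp
  \<comment> \<open>The error bound for one user whose message is \<open>b\<close>; averaging it
    over \<open>b\<close> brings in the codebook bound.\<close>
  define g where "g b = ?e1 + (\<Sum>m\<in>{1..M} - {b}. ?e2 * exp (t * \<rho> m b))" for b
  have "(\<Sum>b\<in>{1..M}. g b) = real M * ?e1 + ?e2 * (\<Sum>b\<in>{1..M}. \<Sum>m\<in>{1..M} - {b}. exp (t * \<rho> m b))"
    by (simp add: g_def sum.distrib sum_distrib_left)
  also have "\<dots> \<le> real M * ?e1 + ?e2 * ((real M)\<^sup>2 * cosh t ^ L)"
    using s_le by (intro add_left_mono mult_left_mono) (auto simp: \<rho>_def)
  also have "cosh t ^ L \<le> exp (real L * t\<^sup>2)"
    using power_mono[OF cosh_le_exp_square[OF t], of L] by (simp add: exp_of_nat_mult)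
  also have "exp (real L * t\<^sup>2) \<le> exp (\<delta> * E / N0)" using t2 by simp
  also have "real M * ?e1 + ?e2 * ((real M)\<^sup>2 * exp (\<delta> * E / N0)) =
      real M * (?e1 + real M * (?e2 * exp (\<delta> * E / N0)))"
    by (simp add: power2_eq_square algebra_simps)
  also have "?e2 * exp (\<delta> * E / N0) = exp (- (1 - 3 * \<delta>) * E / N0)"
    using N0 by (simp add: exp_add[symmetric] field_simps)
  finally have g_sum: "(\<Sum>b\<in>{1..M}. g b) / real M \<le> ?e1 + real M * exp (- (1 - 3 * \<delta>) * E / N0)"
    using Mp by (simp add: divide_le_eq mult.commute)
  have "joint_error_prob N0 K n M x d \<le> (\<Sum>w\<in>?W. \<Sum>i\<in>{1..K}. g (w i)) / real M ^ K"
    unfolding joint_error_prob_eq[OF N0 M dec] \<sigma>_def[symmetric] g_def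
    by (intro divide_right_mono sum_mono err) auto
  also have "(\<Sum>w\<in>?W. \<Sum>i\<in>{1..K}. g (w i)) = (\<Sum>i\<in>{1..K}. real M ^ K * ((\<Sum>b\<in>{1..M}. g b) / real M))"
    using M by (subst sum.swap, intro sum.cong refl, subst sum_PiE_coordinate) auto
  also have "\<dots> / real M ^ K = real K * ((\<Sum>b\<in>{1..M}. g b) / real M)"
    using Mp by simp
  also have "\<dots> \<le> real K * (?e1 + real M * exp (- (1 - 3 * \<delta>) * E / N0))"
    by (intro mult_left_mono g_sum) auto
  finally have "joint_error_prob N0 K n M x d \<le> real K * (?e1 + real M * exp (- (1 - 3 * \<delta>) * E / N0))" .
  then have "symmetric_code N0 K n M E (real K * (?e1 + real M * exp (- (1 - 3 * \<delta>) * E / N0))) x d"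
    using dec energy by (auto simp: symmetric_code_def)
  then show ?thesis by blast
qed

section \<open>Rates per unit-energy\<close>

lemma symmetric_code_mono:
  "symmetric_code N0 K n M E \<epsilon> x d \<Longrightarrow> \<epsilon> \<le> \<epsilon>' \<Longrightarrow> symmetric_code N0 K n M E \<epsilon>' x d"
  by (auto simp: symmetric_code_def)

text \<open>A single message is always decoded correctly and has rate \<open>0\<close>. Since
  \<open>E\<close> must be positive, \<open>E = 1\<close> is allotted although the codewords
  vanish.\<close>

lemma achievable_zero:
  assumes \<epsilon>: "\<epsilon> > 0"
  shows "achievable N0 k \<epsilon> 0"
  unfolding achievable_def
proof (intro allI impI, rule exI[of _ 0], intro allI impI)
  fix \<delta> :: real and n :: nat assume \<delta>: "\<delta> > 0"
  let ?d = "\<lambda>_. \<lambda>i\<in>{1..k n}. 1 :: nat"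
  have sp: "space (message_space (k n) 1) = {1..k n} \<rightarrow>\<^sub>E {1}"
    by (simp add: message_space_def space_PiM space_uniform_count_measure)
  have "w = ?d y" if "w \<in> {1..k n} \<rightarrow>\<^sub>E {1}" for w y
    using that by (auto simp: fun_eq_iff PiE_iff extensional_def)
  then have "{(w, z) \<in> space (message_space (k n) 1 \<Otimes>\<^sub>M noise_space N0 n).
      ?d (channel_output (k n) n (\<lambda>_ _ _. 0) w z) \<noteq> w} = {}"
    by (auto simp: space_pair_measure sp)
  then have "joint_error_prob N0 (k n) n 1 (\<lambda>_ _ _. 0) ?d = 0"
    unfolding joint_error_prob_def by (simp only: measure_empty)
  moreover have "?d \<in> decoders (k n) n 1"
    unfolding decoders_def by (intro measurable_const) auto
  ultimately have "symmetric_code N0 (k n) n 1 1 \<epsilon> (\<lambda>_ _ _. 0) ?d"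
    using \<epsilon> by (simp add: symmetric_code_def)
  then show "\<exists>M\<ge>1. \<exists>E>0. (\<exists>x d. symmetric_code N0 (k n) n M E \<epsilon> x d) \<and> log 2 (real M) / E > 0 - \<delta>"
    using \<delta> by (intro exI[of _ 1] conjI) auto
qed

text \<open>A rate above capacity satisfies the single-user bound only while \<open>E\<close> stays
  below a constant \<open>B\<close>. An unbounded number of users rules this out through the
  identification bound.\<close>

lemma achievable_le_single_user_capacity:
  assumes N0: "N0 > 0" and k: "\<And>n. n \<ge> 1 \<Longrightarrow> k n \<ge> 1" and \<epsilon>: "\<epsilon> > 0" "\<epsilon> < 1"
    and lim: "(\<lambda>n. real (k n)) \<in> \<omega>(\<lambda>_. 1)" and ach: "achievable N0 k \<epsilon> R"
  shows "R \<le> log 2 (exp 1) / N0"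
proof (rule ccontr)
  define C where "C = log 2 (exp 1) / N0"
  define \<delta> where "\<delta> = (R - C) / 3"
  define l where "l = ln (2 / (1 - \<epsilon>))"
  \<comment> \<open>This makes \<open>(1 + r) * C = C + \<delta>\<close>, which leaves a gap
    \<open>\<delta>\<close> to the rate \<open>C + 2 * \<delta>\<close> of the code.\<close>
  define r where "r = \<delta> / C"
  define B where "B = (1 + 1 / r) * l / (ln 2 * \<delta>)"
  assume "\<not> R \<le> log 2 (exp 1) / N0"
  then have \<delta>: "\<delta> > 0" by (simp add: \<delta>_def C_def)
  have C: "C > 0" and C_eq: "C * ln 2 = 1 / N0" using N0 by (auto simp: C_def log_def)
  have r: "r > 0" using \<delta> C by (simp add: r_def)
  obtain n0 where n0: "\<And>n. n \<ge> n0 \<Longrightarrow> \<exists>M\<ge>1. \<exists>E>0. (\<exists>x d. symmetric_code N0 (k n) n M E \<epsilon> x d) \<and>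
      log 2 (real M) / E > R - \<delta>"
    using ach \<delta> unfolding achievable_def by blast
  \<comment> \<open>With this many users the identification bound forces
    \<open>E \<ge> B\<close>.\<close>
  have "eventually (\<lambda>n. real (k n) \<ge> exp (8 * B / N0 + 2 * l)) at_top"
    using smallomegaD[OF lim, of "exp (8 * B / N0 + 2 * l)"] by simp
  moreover have "eventually (\<lambda>n. n \<ge> n0 \<and> n \<ge> 1) at_top"
    by (intro eventually_conj eventually_ge_at_top)
  ultimately have "eventually (\<lambda>n. real (k n) \<ge> exp (8 * B / N0 + 2 * l) \<and> n \<ge> n0 \<and> n \<ge> 1) at_top"
    by eventually_elim auto
  then obtain n where n: "real (k n) \<ge> exp (8 * B / N0 + 2 * l)" "n \<ge> n0" "n \<ge> 1"
    by (auto simp: eventually_at_top_linorder)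
  obtain M E x d where M: "M \<ge> 1" and E: "E > 0" and code: "symmetric_code N0 (k n) n M E \<epsilon> x d"
    and rate: "log 2 (real M) / E > R - \<delta>"
    using n0[OF n(2)] by blast
  have R_eq: "R - \<delta> = C + 2 * \<delta>" by (simp add: \<delta>_def field_simps)
  have rate': "log 2 (real M) > (C + 2 * \<delta>) * E"
    using rate E unfolding R_eq by (simp only: less_divide_eq if_True)
  \<comment> \<open>A single message has rate zero; the identification bound needs two.\<close>
  have "M \<ge> 2"
  proof (rule ccontr)
    assume "\<not> M \<ge> 2"
    then have "M = 1" using M by simp
    then show False using rate' C \<delta> E by (simp add: mult_less_0_iff)
  qed
  have "ln (real M) \<le> (1 + r) * E / N0 + (1 + 1 / r) * l"
    unfolding l_def by (rule converse_single_user[OF N0 M \<epsilon>(2) code k[OF n(3)] r])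
  also have "(1 + r) * E / N0 = (1 + r) * E * (C * ln 2)" unfolding C_eq by simp
  also have "\<dots> = (C + \<delta>) * E * ln 2" using C by (simp add: r_def field_simps)
  finally have "ln (real M) \<le> (C + \<delta>) * E * ln 2 + (1 + 1 / r) * l" .
  moreover have "(C + 2 * \<delta>) * E * ln 2 < ln (real M)"
    using rate' by (simp add: log_def less_divide_eq)
  ultimately have "(C + 2 * \<delta>) * E * ln 2 < (C + \<delta>) * E * ln 2 + (1 + 1 / r) * l" by linarith
  then have "E * (ln 2 * \<delta>) < (1 + 1 / r) * l" by (simp add: algebra_simps)
  then have "E < B" unfolding B_def using \<delta> by (subst less_divide_eq) auto
  moreover have "ln (real (k n)) \<le> 8 * E / N0 + 2 * l"
    unfolding l_def by (rule converse_user_identification[OF N0 \<open>M \<ge> 2\<close> \<epsilon>(2) code k[OF n(3)]])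
  moreover have "ln (real (k n)) \<ge> 8 * B / N0 + 2 * l"
    using n(1) k[OF n(3)] by (subst ln_ge_iff) auto
  ultimately have "8 * B / N0 \<le> 8 * E / N0" "E < B" by auto
  then show False using N0 by (simp add: divide_le_cancel)
qed

text \<open>Identification forces \<open>E\<close> to be at least of order \<open>ln n\<close>,
  hence the energy per symbol \<open>u = k * E / n\<close> exceeds any prescribed constant. The sum
  rate grows only logarithmically in \<open>u\<close>, whereas a positive rate requires linear
  growth.\<close>

lemma achievable_nonpos:
  assumes N0: "N0 > 0" and k: "\<And>n. n \<ge> 1 \<Longrightarrow> k n \<ge> 1" and \<epsilon>: "\<epsilon> > 0" "\<epsilon> < 1"
    and lim: "(\<lambda>n. real (k n)) \<in> \<omega>(\<lambda>n. real n / log 2 (real n))" and ach: "achievable N0 k \<epsilon> R"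
  shows "R \<le> 0"
proof (rule ccontr)
  assume "\<not> R \<le> 0"
  then have R: "R > 0" by simp
  \<comment> \<open>Half of the rate in nats: with slack \<open>R / 2\<close> the code satisfies
    \<open>ln M > R' * E\<close>.\<close>
  define R' where "R' = R / 2 * ln 2"
  define l where "l = ln (2 / (1 - \<epsilon>))"
  \<comment> \<open>The linear bound on \<open>ln (1 + 2 * u / N0)\<close> with parameter
    \<open>a\<close> has slope \<open>2 * a / N0 = R'\<close> in \<open>u\<close>. After the factor
    \<open>n / 2\<close> it takes up only half of the left side.\<close>
  define a where "a = R' * N0 / 2"
  define c3 where "c3 = 2 / (1 - \<epsilon>) + l + (a - 1 - ln a) / 2"
  \<comment> \<open>The second entry gives \<open>u \<ge> 2 * c3 / R' + 1\<close> once
    \<open>E \<ge> N0 * ln n / 32\<close>; the first ensures at least \<open>n / log 2 n\<close>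
    users.\<close>
  define A where "A = max 1 (32 / (N0 * ln 2) * (2 * c3 / R' + 1))"
  have R': "R' > 0" using R by (simp add: R'_def)
  have a: "a > 0" using R' N0 by (simp add: a_def)
  have l: "l > 0" using \<epsilon> by (simp add: l_def)
  obtain n0 where n0: "\<And>n. n \<ge> n0 \<Longrightarrow> \<exists>M\<ge>1. \<exists>E>0. (\<exists>x d. symmetric_code N0 (k n) n M E \<epsilon> x d) \<and>
      log 2 (real M) / E > R - R / 2"
    using ach R half_gt_zero[OF R] unfolding achievable_def by blast
  have "eventually (\<lambda>n. real (k n) \<ge> A * norm (real n / log 2 (real n))) at_top"
    using smallomegaD[OF lim, of A] by simp
  moreover have "eventually (\<lambda>n. log 2 (real n) \<le> sqrt (real n)) at_top" by real_asymp
  moreover have "eventually (\<lambda>n. ln (real n) \<ge> 8 * l) at_top" by real_asymp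
  moreover have "eventually (\<lambda>n. n \<ge> n0 \<and> n \<ge> 2) at_top"
    by (intro eventually_conj eventually_ge_at_top)
  ultimately have "eventually (\<lambda>n. real (k n) \<ge> A * norm (real n / log 2 (real n)) \<and>
      log 2 (real n) \<le> sqrt (real n) \<and> ln (real n) \<ge> 8 * l \<and> n \<ge> n0 \<and> n \<ge> 2) at_top"
    by eventually_elim auto
  then obtain n where kn: "real (k n) \<ge> A * norm (real n / log 2 (real n))"
    and log_sqrt: "log 2 (real n) \<le> sqrt (real n)" and ln_l: "ln (real n) \<ge> 8 * l"
    and n: "n \<ge> n0" "n \<ge> 2"
    by (auto simp: eventually_at_top_linorder)
  obtain M E x d where M: "M \<ge> 1" and E: "E > 0" and code: "symmetric_code N0 (k n) n M E \<epsilon> x d"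
    and rate: "log 2 (real M) / E > R - R / 2"
    using n0[OF n(1)] by blast
  have n1: "n \<ge> 1" using n by simp
  have K: "k n \<ge> 1" by (rule k[OF n1])
  have rate': "ln (real M) > R' * E"
    using rate E by (simp add: R'_def log_def field_simps)
  have M2: "M \<ge> 2"
  proof (rule ccontr)
    assume "\<not> M \<ge> 2"
    then have "M = 1" using M by simp
    then show False using rate' R' E by (simp add: mult_less_0_iff)
  qed
  have ln_n: "ln (real n) > 0" and log_n: "log 2 (real n) > 0" using n by auto
  have kn': "real (k n) \<ge> A * (real n / log 2 (real n))" using kn log_n by simp
  have A: "A \<ge> 1" "A \<ge> 32 / (N0 * ln 2) * (2 * c3 / R' + 1)" by (auto simp: A_def)
  \<comment> \<open>There are at least \<open>sqrt n\<close> users, so \<open>ln k\<close> is at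
    least half of \<open>ln n\<close>.\<close>
  have "sqrt (real n) * log 2 (real n) \<le> sqrt (real n) * sqrt (real n)"
    using log_sqrt by (intro mult_left_mono) auto
  then have "sqrt (real n) \<le> real n / log 2 (real n)"
    using log_n by (simp add: le_divide_eq)
  also have "\<dots> \<le> A * (real n / log 2 (real n))"
    using mult_right_mono[OF A(1), of "real n / log 2 (real n)"] log_n by simp
  also note kn'
  finally have "ln (sqrt (real n)) \<le> ln (real (k n))" using n by (intro ln_mono) auto
  then have ln_k: "ln (real n) / 2 \<le> ln (real (k n))" using n by (simp add: ln_sqrt)
  have "ln (real (k n)) \<le> 8 * E / N0 + 2 * l"
    unfolding l_def by (rule converse_user_identification[OF N0 M2 \<epsilon>(2) code K])
  then have "ln (real n) / 4 \<le> 8 * E / N0" using ln_k ln_l by linarith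
  then have E_ge: "N0 * ln (real n) / 32 \<le> E" using N0 by (simp add: field_simps)
  define u where "u = real (k n) * E / real n"
  have "A * (N0 * ln 2 / 32) = A * (real n / log 2 (real n)) * (N0 * ln (real n) / 32) / real n"
    using n ln_n by (simp add: log_def field_simps)
  also have "\<dots> \<le> real (k n) * E / real n"
    using kn' E_ge N0 ln_n log_n A by (intro divide_right_mono mult_mono) auto
  finally have "A * (N0 * ln 2 / 32) \<le> u" by (simp add: u_def)
  moreover have "2 * c3 / R' + 1 \<le> A * (N0 * ln 2 / 32)"
    using A(2) N0 by (simp add: field_simps)
  ultimately have u_ge: "2 * c3 / R' + 1 \<le> u" by linarith
  have u: "u > 0" using K E n by (simp add: u_def)
  have "real (k n) * (R' * E) < real (k n) * ln (real M)"
    using rate' K by (intro mult_strict_left_mono) auto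
  also have "\<dots> \<le> real n / 2 * ln (1 + 2 * real (k n) * E / (real n * N0)) + 2 * real n / (1 - \<epsilon>) + l"
    unfolding l_def by (rule converse_sum_rate[OF N0 M \<epsilon>(2) code E n1])
  also have "2 * real (k n) * E / (real n * N0) = 2 * u / N0" by (simp add: u_def)
  also have "ln (1 + 2 * u / N0) \<le> a * (1 + 2 * u / N0) - 1 - ln a"
  proof -
    have "1 + 2 * u / N0 > 0" using u N0 by (simp add: add_pos_pos)
    then show ?thesis
      using ln_le_minus_one[of "a * (1 + 2 * u / N0)"] a by (simp add: ln_mult_pos)
  qed
  also have "a * (1 + 2 * u / N0) - 1 - ln a = R' * u + (a - 1 - ln a)"
    using N0 by (simp add: a_def field_simps)
  \<comment> \<open>Every term now carries a factor \<open>n\<close>, which cancels.\<close>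
  also have "l \<le> real n * l" using n1 l by simp
  finally have "real (k n) * (R' * E) <
      real n / 2 * (R' * u + (a - 1 - ln a)) + 2 * real n / (1 - \<epsilon>) + real n * l"
    using n1 by simp
  also have "\<dots> = real n * (R' * u / 2 + c3)" by (simp add: c3_def field_simps)
  also have "real (k n) * (R' * E) = real n * (R' * u)" using n by (simp add: u_def)
  finally have "R' * u < R' * u / 2 + c3" using n1 by simp
  then have "u < 2 * c3 / R'" using R' by (simp add: field_simps)
  then show False using u_ge by simp
qed

text \<open>This turns the growth condition on the number of users into blocks longer than any fixed
  multiple of \<open>ln n\<close>.\<close>

lemma block_length_large:
  fixes k :: "nat \<Rightarrow> nat"
  assumes lim: "(\<lambda>n. real (k n)) \<in> o(\<lambda>n. real n / log 2 (real n))"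
    and k: "\<And>n. n \<ge> 1 \<Longrightarrow> k n \<ge> 1" and c: "c \<ge> 0"
  shows "eventually (\<lambda>n. real (n div k n) \<ge> c * ln (real n)) at_top"
proof -
  \<comment> \<open>The summand \<open>1 / ln 2\<close> added to \<open>c\<close> pays for rounding
    in \<open>n div k n\<close>, which loses less than one, while \<open>ln n / ln 2 \<ge> 1\<close>
    for \<open>n \<ge> 2\<close>.\<close>
  define b where "b = 1 / (ln 2 * (c + 1 / ln 2))"
  have b: "b > 0" using c by (simp add: b_def add_nonneg_pos)
  have "eventually (\<lambda>n. norm (real (k n)) \<le> b * norm (real n / log 2 (real n))) at_top"
    by (rule landau_o.smallD[OF lim b])
  moreover have "eventually (\<lambda>n. n \<ge> (2::nat)) at_top" by (rule eventually_ge_at_top)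
  ultimately show ?thesis
  proof eventually_elim
    case (elim n)
    then have ln_n: "ln (real n) \<ge> ln 2" and pos: "ln (real n) > 0" by auto
    have kn: "real (k n) > 0" using k[of n] elim by simp
    have D: "ln (real n) * (c + 1 / ln 2) > 0"
      using pos c by (intro mult_pos_pos add_nonneg_pos) auto
    have "real (k n) \<le> b * (real n / log 2 (real n))" using elim pos by (simp add: log_def)
    also have "\<dots> = real n / (ln (real n) * (c + 1 / ln 2))" by (simp add: b_def log_def)
    finally have "real (k n) * (ln (real n) * (c + 1 / ln 2)) \<le> real n"
      using D by (simp only: le_divide_eq if_True)
    then have "ln (real n) * (c + 1 / ln 2) \<le> real n / real (k n)"
      using kn by (simp add: le_divide_eq mult.commute)
    moreover have "1 \<le> ln (real n) * (1 / ln 2)" using ln_n by simp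
    moreover have "real n / real (k n) < real (n div k n) + 1"
      using floor_divide_of_nat_eq[of n "k n", where ?'a = real]
        floor_correct[of "real n / real (k n)"] by simp
    ultimately have "ln (real n) * c \<le> real (n div k n)" unfolding distrib_left by linarith
    then show ?case by (simp only: mult.commute)
  qed
qed

text \<open>The energy is chosen so that \<open>\<delta>\<^sup>2 * E / N0 = 2 * ln n\<close>. Each
  user then errs with probability at most \<open>2 / n\<^sup>2\<close>, and at most \<open>n\<close>
  users give \<open>2 / n\<close> in total.\<close>

lemma achievable_single_user_capacity:
  assumes N0: "N0 > 0" and k: "\<And>n. n \<ge> 1 \<Longrightarrow> k n \<ge> 1" and \<epsilon>: "\<epsilon> > 0"
    and lim: "(\<lambda>n. real (k n)) \<in> o(\<lambda>n. real n / log 2 (real n))"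
  shows "achievable N0 k \<epsilon> (log 2 (exp 1) / N0)"
  unfolding achievable_def
proof (intro allI impI)
  fix \<eta> :: real assume \<eta>: "\<eta> > 0"
  define C where "C = log 2 (exp 1) / N0"
  have C: "C > 0" and C_eq: "C = 1 / (N0 * ln 2)" using N0 by (auto simp: C_def log_def)
  \<comment> \<open>The rate loss \<open>4 * \<delta> * C\<close> takes half of
    \<open>\<eta>\<close>; the other half is for rounding \<open>M\<close>.\<close>
  define \<delta> where "\<delta> = min (1 / 8) (\<eta> / (8 * C))"
  have \<delta>: "0 < \<delta>" "\<delta> \<le> 1" "4 * \<delta> \<le> 1" and \<delta>C: "4 * \<delta> * C \<le> \<eta> / 2"
  proof -
    show "0 < \<delta>" "\<delta> \<le> 1" "4 * \<delta> \<le> 1" using \<eta> C by (auto simp: \<delta>_def)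
    have "\<delta> \<le> \<eta> / (8 * C)" by (simp add: \<delta>_def)
    then show "4 * \<delta> * C \<le> \<eta> / 2" using C by (simp add: field_simps)
  qed
  define E where "E n = 2 * N0 / \<delta>\<^sup>2 * ln (real n)" for n :: nat
  have "filterlim (\<lambda>n. ln (real n)) at_top at_top" by real_asymp
  then have "eventually (\<lambda>n. ln (real n) > 1 / \<eta> * \<delta>\<^sup>2 / N0) at_top"
    by (rule filterlim_at_top_dense[THEN iffD1, rule_format])
  \<comment> \<open>With \<open>E = 2 * N0 / \<delta>\<^sup>2 * ln n\<close>, this is the
    requirement \<open>4 * E / (N0 * L) \<le> \<delta>\<close> of the block code.\<close>
  moreover have "eventually (\<lambda>n. real (n div k n) \<ge> (8 / \<delta> ^ 3) * ln (real n)) at_top"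
    using \<delta> by (intro block_length_large[OF lim k]) auto
  moreover have "eventually (\<lambda>n. 2 / real n \<le> \<epsilon>) at_top" using \<epsilon> by real_asymp
  moreover have "eventually (\<lambda>n. n \<ge> (2::nat)) at_top" by (rule eventually_ge_at_top)
  ultimately have "eventually (\<lambda>n. \<exists>M\<ge>1. \<exists>E>0. (\<exists>x d. symmetric_code N0 (k n) n M E \<epsilon> x d) \<and>
      log 2 (real M) / E > C - \<eta>) at_top"
  proof eventually_elim
    case (elim n)
    have ln_n: "ln (real n) > 0" using elim by simp
    have E: "E n > 0" using ln_n N0 \<delta> by (simp add: E_def)
    have E_eq: "\<delta>\<^sup>2 * E n / N0 = 2 * ln (real n)" using N0 \<delta> by (simp add: E_def)
    have "real (n div k n) > 0"
      using elim(2) ln_n \<delta> by (smt (verit) divide_pos_pos mult_pos_pos zero_less_power)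
    then have L: "n div k n \<ge> 1" by linarith
    have kn: "k n \<le> n" using L by (metis div_less leI not_one_le_zero)
    have kL: "k n * (n div k n) \<le> n" by simp
    have EL: "4 * E n / (N0 * real (n div k n)) \<le> \<delta>"
    proof -
      have "4 * E n / N0 = \<delta> * ((8 / \<delta> ^ 3) * ln (real n))"
        using N0 \<delta> by (simp add: E_def power2_eq_square power3_eq_cube)
      also have "\<dots> \<le> \<delta> * real (n div k n)" using elim(2) \<delta> by (intro mult_left_mono) auto
      finally have "4 * E n / N0 / real (n div k n) \<le> \<delta>" using L by (subst divide_le_eq) auto
      then show ?thesis by simp
    qed
    \<comment> \<open>One \<open>\<delta>\<close> below the exponent \<open>1 - 3 * \<delta>\<close>
      of the block code, so that the competitors' error also decays. Rounding down loses at most a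
      factor two, that is, \<open>1 / E\<close> in the rate.\<close>
    define X where "X = exp ((1 - 4 * \<delta>) * E n / N0)"
    define M where "M = nat \<lfloor>X\<rfloor>"
    have X: "X \<ge> 1" using \<delta> E N0 by (simp add: X_def)
    have floor_X: "1 \<le> \<lfloor>X\<rfloor>" using X by simp
    then have M_eq: "real M = real_of_int \<lfloor>X\<rfloor>" by (simp add: M_def)
    have M: "M \<ge> 1" and MX: "real M \<le> X" and M_ge: "X / 2 \<le> real M"
      using floor_X unfolding M_eq by (simp add: M_def le_nat_iff, simp, linarith)
    obtain x d where code: "symmetric_code N0 (k n) n M (E n)
        (real (k n) * (exp (- \<delta>\<^sup>2 * E n / N0) + real M * exp (- (1 - 3 * \<delta>) * E n / N0))) x d"
      using exists_block_code[OF N0 E M L kL \<delta>(1,2) EL] by blast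
    have "real M * exp (- (1 - 3 * \<delta>) * E n / N0) \<le> X * exp (- (1 - 3 * \<delta>) * E n / N0)"
      using MX by (intro mult_right_mono) auto
    also have "\<dots> = exp (- (\<delta> * E n / N0))"
      using N0 by (simp add: X_def exp_add[symmetric] field_simps)
    also have "\<dots> \<le> exp (- (\<delta>\<^sup>2 * E n / N0))"
      using \<delta> E N0 mult_right_mono[of \<delta> 1 \<delta>]
      by (simp add: power2_eq_square divide_right_mono mult_right_mono)
    finally have "real (k n) * (exp (- \<delta>\<^sup>2 * E n / N0) + real M * exp (- (1 - 3 * \<delta>) * E n / N0)) \<le>
        real n * (2 * exp (- (\<delta>\<^sup>2 * E n / N0)))"
      using kn by (intro mult_mono) auto
    also have "exp (- (\<delta>\<^sup>2 * E n / N0)) = 1 / (real n)\<^sup>2"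
    proof -
      have "exp (2 * ln (real n)) = exp (ln (real n)) ^ 2" by (simp add: exp_double)
      then show ?thesis using elim(4) unfolding E_eq by (simp add: exp_minus inverse_eq_divide)
    qed
    also have "real n * (2 * (1 / (real n)\<^sup>2)) = 2 / real n" by (simp add: power2_eq_square)
    also have "\<dots> \<le> \<epsilon>" by (rule elim(3))
    finally have code': "symmetric_code N0 (k n) n M (E n) \<epsilon> x d"
      by (rule symmetric_code_mono[OF code])
    have "(1 - 4 * \<delta>) * E n / N0 - ln 2 = ln (X / 2)"
      by (subst ln_div) (auto simp: X_def)
    also have "\<dots> \<le> ln (real M)" using M_ge X by (intro ln_mono) auto
    finally have "((1 - 4 * \<delta>) * E n / N0 - ln 2) / ln 2 / E n \<le> ln (real M) / ln 2 / E n"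
      using E by (intro divide_right_mono) auto
    then have "C - 4 * \<delta> * C - 1 / E n \<le> log 2 (real M) / E n"
      using E N0 by (simp add: C_eq log_def diff_divide_distrib left_diff_distrib)
    moreover have "1 / E n < \<eta> / 2"
      using elim(1) \<eta> N0 \<delta> ln_n by (simp add: E_def field_simps)
    ultimately have "log 2 (real M) / E n > C - \<eta>" using \<delta>C by linarith
    then show ?case using M E code' by blast
  qed
  then show "\<exists>n0. \<forall>n\<ge>n0. \<exists>M\<ge>1. \<exists>E>0. (\<exists>x d. symmetric_code N0 (k n) n M E \<epsilon> x d) \<and>
      log 2 (real M) / E > log 2 (exp 1) / N0 - \<eta>"
    by (simp add: eventually_at_top_linorder C_def)
qed

lemma capacity_eqI:
  assumes "achievable N0 k \<epsilon> C" "\<And>R. achievable N0 k \<epsilon> R \<Longrightarrow> R \<le> C"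
  shows "capacity_per_unit_energy N0 k \<epsilon> = ereal C"
  unfolding capacity_per_unit_energy_def
  using assms by (intro antisym SUP_least SUP_upper) auto

theorem theorem13:
  fixes N0 :: real and k :: "nat \<Rightarrow> nat"
  assumes "N0 > 0"
    and "\<And>n. n \<ge> 1 \<Longrightarrow> k n \<ge> 1"
  shows "((\<lambda>n. real (k n)) \<in> \<omega>(\<lambda>_. 1) \<and>
          (\<lambda>n. real (k n)) \<in> o(\<lambda>n. real n / log 2 (real n)) \<longrightarrow>
            (\<forall>\<epsilon>::real. 0 < \<epsilon> \<and> \<epsilon> < 1 \<longrightarrow>
              capacity_per_unit_energy N0 k \<epsilon> = ereal (log 2 (exp 1) / N0))) \<and>
         ((\<lambda>n. real (k n)) \<in> \<omega>(\<lambda>n. real n / log 2 (real n)) \<longrightarrow>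
            (\<forall>\<epsilon>::real. 0 < \<epsilon> \<and> \<epsilon> < 1 \<longrightarrow>
              capacity_per_unit_energy N0 k \<epsilon> = 0))"
proof (intro conjI impI allI; elim conjE)
  fix \<epsilon> :: real
  assume \<epsilon>: "0 < \<epsilon>" "\<epsilon> < 1"
  show "capacity_per_unit_energy N0 k \<epsilon> = ereal (log 2 (exp 1) / N0)"
    if "(\<lambda>n. real (k n)) \<in> \<omega>(\<lambda>_. 1)" "(\<lambda>n. real (k n)) \<in> o(\<lambda>n. real n / log 2 (real n))"
    using that assms \<epsilon>
    by (intro capacity_eqI achievable_single_user_capacity achievable_le_single_user_capacity)
  show "capacity_per_unit_energy N0 k \<epsilon> = 0"
    if "(\<lambda>n. real (k n)) \<in> \<omega>(\<lambda>n. real n / log 2 (real n))"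
    \<comment> \<open>This exposes \<open>0\<close> as \<open>ereal 0\<close>, the form in which
      \<open>capacity_eqI\<close> concludes.\<close>
    unfolding zero_ereal_def
    by (rule capacity_eqI[OF achievable_zero[OF \<epsilon>(1)] achievable_nonpos[OF assms \<epsilon> that]])
qed

end
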